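(* Let $A$ be a von Neumann algebra or a simple $C^{\star}$-algebra with unity. Suppose that $\delta:A\rightarrow A$ is a continuous linear map. Then: (i) $\delta$ satisfies \[ \text{for all } a,b\in A:\quad ab=0\Longrightarrow b\,\delta(a)+\delta(b)\,a=0 \] if and only if there are elements $\mu,\nu\in A$ such that $\delta(a)=a\mu-\nu a$ for all $a\in A$, where $\mu-\nu\in\mathcal{Z}(A)$ and \[ [[a,b],\mu]+2[a,b](\mu-\nu)=0 \quad\text{for all } a,b\in A. \] (ii) $\delta$ satisfies \[ \text{for all } a,b\in A:\quad ab^{\star}=0\Longrightarrow \delta(b)^{\star}a+b^{\star}\delta(a)=0 \] if and only if there are elements $\mu,\nu\in A$ such that $\delta(a)=a\nu-\mu a$ for all $a\in A$, $\operatorname{Re}\mu\in\mathcal{Z}(A)$ and \[ [[a,b],\mu]+(\nu-\mu)^{\star}[a,b]+[a,b](\nu-\mu)=0 \quad\text{for all } a,b\in A. \] (iii) $\delta$ satisfies \[ \text{for all } a,b\in A:\quad a^{\star}b=0\Longrightarrow \delta(b)\,a^{\star}+b\,\delta(a)^{\star}=0 \] if and only if there are elements $\mu,\nu\in A$ such that $\delta(a)=a\mu-\nu a$ for all $a\in A$, $\operatorname{Re}\mu\in\mathcal{Z}(A)$ and \[ [[a,b],\mu]+[a,b](\mu-\nu)^{\star}+(\mu-\nu)[a,b]=0 \quad\text{for all } a,b\in A. \]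
   Context: All algebras are over $\mathbb{C}$. $\mathcal{Z}(A)$ denotes the centre of $A$, $[x,y]=xy-yx$ is the commutator, and $\operatorname{Re}\mu=\frac12(\mu+\mu^{\star})$. Continuity is with respect to the norm topology. *)

theory Defs
  imports "HOL-Analysis.Analysis"
begin

section \<open>Complex normed spaces and Hilbert spaces\<close>

class scaleC =
  fixes scaleC :: "complex \<Rightarrow> 'a \<Rightarrow> 'a"  (infixr \<open>*\<^sub>C\<close> 75)

class complex_normed_vector = real_normed_vector + scaleC +
  assumes scaleC_add_right: "c *\<^sub>C (x + y) = c *\<^sub>C x + c *\<^sub>C y"
    and scaleC_add_left: "(c + d) *\<^sub>C x = c *\<^sub>C x + d *\<^sub>C x"
    and scaleC_scaleC: "c *\<^sub>C (d *\<^sub>C x) = (c * d) *\<^sub>C x"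
    and scaleC_of_real: "complex_of_real r *\<^sub>C x = r *\<^sub>R x"
    and norm_scaleC: "norm (c *\<^sub>C x) = cmod c * norm x"

definition clinear :: "('a::complex_normed_vector \<Rightarrow> 'b::complex_normed_vector) \<Rightarrow> bool"
  where "clinear f \<longleftrightarrow> (\<forall>x y. f (x + y) = f x + f y) \<and> (\<forall>c x. f (c *\<^sub>C x) = c *\<^sub>C f x)"

text \<open>The inner product is linear in the first argument. Positive definiteness follows
  from the last axiom.\<close>

class complex_hilbert_space = complex_normed_vector + complete_space +
  fixes cinner :: "'a \<Rightarrow> 'a \<Rightarrow> complex"
  assumes cinner_commute: "cinner x y = cnj (cinner y x)"
    and cinner_add_left: "cinner (x + y) z = cinner x z + cinner y z"
    and cinner_scaleC_left: "cinner (c *\<^sub>C x) y = c * cinner x y"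
    and cinner_self: "cinner x x = complex_of_real ((norm x)\<^sup>2)"

section \<open>Unital C*-algebras\<close>

class star =
  fixes star :: "'a \<Rightarrow> 'a"  (\<open>_\<^sup>\<star>\<close> [1000] 999)

text \<open>The unit is provided by \<^class>\<open>monoid_mult\<close> rather than by
  \<^class>\<open>real_normed_algebra_1\<close>, because the latter excludes the zero algebra.\<close>

class unital_cstar_algebra =
  complex_normed_vector + real_normed_algebra + monoid_mult + complete_space + star +
  assumes mult_scaleC_left: "(c *\<^sub>C x) * y = c *\<^sub>C (x * y)"
    and mult_scaleC_right: "x * (c *\<^sub>C y) = c *\<^sub>C (x * y)"
    and star_star: "(x\<^sup>\<star>)\<^sup>\<star> = x"
    and star_add: "(x + y)\<^sup>\<star> = x\<^sup>\<star> + y\<^sup>\<star>"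
    and star_scaleC: "(c *\<^sub>C x)\<^sup>\<star> = cnj c *\<^sub>C x\<^sup>\<star>"
    and star_mult: "(x * y)\<^sup>\<star> = y\<^sup>\<star> * x\<^sup>\<star>"
    and cstar_identity: "norm (x\<^sup>\<star> * x) = (norm x)\<^sup>2"

definition centre :: "'a::unital_cstar_algebra set"
  where "centre = {z. \<forall>a. z * a = a * z}"

definition commutator :: "'a::unital_cstar_algebra \<Rightarrow> 'a \<Rightarrow> 'a"  (\<open>\<lbrakk>_,/ _\<rbrakk>\<^sub>c\<close>)
  where "\<lbrakk>x, y\<rbrakk>\<^sub>c = x * y - y * x"

definition re_part :: "'a::unital_cstar_algebra \<Rightarrow> 'a"
  where "re_part x = (1/2) *\<^sub>R (x + x\<^sup>\<star>)"

definition closed_ideal :: "'a::unital_cstar_algebra set \<Rightarrow> bool"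
  where "closed_ideal I \<longleftrightarrow> 0 \<in> I \<and> (\<forall>x\<in>I. \<forall>y\<in>I. x + y \<in> I) \<and> (\<forall>c. \<forall>x\<in>I. c *\<^sub>C x \<in> I)
    \<and> (\<forall>a. \<forall>x\<in>I. a * x \<in> I \<and> x * a \<in> I) \<and> closed I"

definition simple_cstar_algebra :: "'a::unital_cstar_algebra itself \<Rightarrow> bool"
  where "simple_cstar_algebra _ \<longleftrightarrow> (\<forall>I::'a set. closed_ideal I \<longrightarrow> I = {0} \<or> I = UNIV)"

section \<open>Von Neumann algebras\<close>

definition is_adjoint ::
    "('h::complex_hilbert_space \<Rightarrow>\<^sub>L 'h) \<Rightarrow> ('h \<Rightarrow>\<^sub>L 'h) \<Rightarrow> bool"
  where "is_adjoint S T \<longleftrightarrow> (\<forall>x y. cinner (T x) y = cinner x (S y))"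

text \<open>A von Neumann algebra on a Hilbert space: a *-subalgebra of the bounded complex-linear
  operators that contains the identity and is closed in the strong operator topology.
  The type \<^typ>\<open>'h \<Rightarrow>\<^sub>L 'h\<close> consists of real-linear operators, hence the explicit
  complex linearity; the complex-linear operators are strongly closed in it, so closedness may
  be taken in the whole type.\<close>

definition von_neumann_algebra :: "('h::complex_hilbert_space \<Rightarrow>\<^sub>L 'h) set \<Rightarrow> bool"
  where "von_neumann_algebra M \<longleftrightarrow>
    (\<forall>T\<in>M. clinear (blinfun_apply T)) \<and>
    id_blinfun \<in> M \<and>
    (\<forall>S\<in>M. \<forall>T\<in>M. S + T \<in> M) \<and>
    (\<forall>c. \<forall>T\<in>M. \<exists>S\<in>M. \<forall>x. S x = c *\<^sub>C T x) \<and>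
    (\<forall>S\<in>M. \<forall>T\<in>M. S o\<^sub>L T \<in> M) \<and>
    (\<forall>T\<in>M. \<exists>S\<in>M. is_adjoint S T) \<and>
    closedin strong_operator_topology M"

text \<open>A *-isomorphism of a C*-algebra onto a von Neumann algebra of operators; such a map is
  automatically isometric.\<close>

definition von_neumann_realization ::
    "('a::unital_cstar_algebra \<Rightarrow> ('h::complex_hilbert_space \<Rightarrow>\<^sub>L 'h)) \<Rightarrow> bool"
  where "von_neumann_realization \<pi> \<longleftrightarrow>
    inj \<pi> \<and> von_neumann_algebra (range \<pi>) \<and>
    (\<forall>a b. \<pi> (a + b) = \<pi> a + \<pi> b) \<and>
    (\<forall>c a x. \<pi> (c *\<^sub>C a) x = c *\<^sub>C \<pi> a x) \<and>
    (\<forall>a b. \<pi> (a * b) = \<pi> a o\<^sub>L \<pi> b) \<and>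
    (\<forall>a. is_adjoint (\<pi> (a\<^sup>\<star>)) (\<pi> a))"

end

theory Submission
  imports Defs "HOL-Complex_Analysis.Cauchy_Integral_Formula" "HOL-Computational_Algebra.Polynomial"
begin

text \<open>
In all three parts the orthogonality condition has the form \<open>a c = 0 \<Longrightarrow> T c a + c S a = 0\<close> for
two bounded linear maps \<open>S\<close>, \<open>T\<close>: part (i) has \<open>S = T = \<delta>\<close>, the other parts combine \<open>\<delta>\<close> with
\<open>\<tau> a = (\<delta> (a\<^sup>\<star>))\<^sup>\<star>\<close>. The proof rests on two facts about unital C*-algebras.

First, they are zero product determined (\<open>zero_product_balanced\<close>): a bounded complex bilinear map
\<open>\<phi>\<close> with \<open>\<phi> a c = 0\<close> whenever \<open>a c = 0\<close> satisfies \<open>\<phi> (a x) c = \<phi> a (x c)\<close>. For self-adjoint \<open>x\<close> this is a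
statement about bilinear forms on \<open>C[-1, 1]\<close> that vanish on functions with disjoint supports
(\<open>id_balanced\<close>), transported by the continuous functional calculus. The latter is built
from the bound of \<open>norm (p(b))\<close> by the supremum of a polynomial \<open>p\<close> on \<open>[-1, 1]\<close>
(\<open>norm_poly_at_le\<close>).

Second, a bounded central valued map that satisfies the Leibniz rule on commuting elements
vanishes (\<open>central_valued_derivation_zero\<close>), because its value at a unitary grows linearly along the
powers of that unitary.

The balanced identity for \<open>\<phi> a c = T c a + c S a\<close> makes \<open>S a - S 1 a\<close> a map of this kind, and
\<open>zero_product_pair_structure\<close> follows: \<open>S\<close> and \<open>T\<close> are the left and the right
multiplication by \<open>S 1\<close> and \<open>T 1\<close>, where \<open>S 1 + T 1\<close> is central and annihilates all
commutators. So \<open>\<delta>\<close> is itself a one-sided multiplication, by \<open>\<delta> 1\<close>, and the elements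
\<open>\<mu>\<close>, \<open>\<nu>\<close> can be read off.
\<close>

section \<open>Basic facts on unital C*-algebras\<close>

lemma norm_star [simp]: "norm (x\<^sup>\<star>) = norm x" for x :: "'a::unital_cstar_algebra"
proof -
  have le: "norm y \<le> norm (y\<^sup>\<star>)" for y :: 'a
  proof (cases "y = 0")
    case False
    have "norm y * norm y \<le> norm (y\<^sup>\<star>) * norm y"
      using cstar_identity[of y] norm_mult_ineq[of "y\<^sup>\<star>" y] by (simp add: power2_eq_square)
    with False show ?thesis by simp
  qed simp
  show ?thesis using le[of x] le[of "x\<^sup>\<star>"] by (simp add: star_star)
qed

lemma star_scaleR: "(r *\<^sub>R x)\<^sup>\<star> = r *\<^sub>R x\<^sup>\<star>" for x :: "'a::unital_cstar_algebra"
  using star_scaleC[of "complex_of_real r" x] by (simp add: scaleC_of_real)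

lemma star_zero [simp]: "(0::'a::unital_cstar_algebra)\<^sup>\<star> = 0"
  using star_scaleR[of 0 "0::'a"] by simp

lemma star_one [simp]: "(1::'a::unital_cstar_algebra)\<^sup>\<star> = 1"
  by (metis mult_1 star_mult star_star)

lemma star_minus: "(- x)\<^sup>\<star> = - x\<^sup>\<star>" for x :: "'a::unital_cstar_algebra"
  using star_scaleR[of "-1" x] by simp

lemma star_diff: "(x - y)\<^sup>\<star> = x\<^sup>\<star> - y\<^sup>\<star>" for x y :: "'a::unital_cstar_algebra"
  using star_add[of x "-y"] by (simp add: star_minus)

lemma bounded_linear_star: "bounded_linear (star :: 'a::unital_cstar_algebra \<Rightarrow> 'a)"
  by (rule bounded_linear_intro[where K = 1]) (auto simp: star_add star_scaleR)

text \<open>With \<open>a = x\<^sup>\<star>\<close> the hypothesis makes \<open>x\<^sup>\<star> x\<close> a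
self-adjoint element of square zero, and the C*-identity kills it. The cancellations
for maps with zero product conditions go through this lemma.\<close>

lemma cstar_semiprime:
  fixes x :: "'a::unital_cstar_algebra"
  assumes "\<And>a. x * a * x = 0"
  shows "x = 0"
proof -
  have "(x\<^sup>\<star> * x)\<^sup>\<star> * (x\<^sup>\<star> * x) = x\<^sup>\<star> * (x * x\<^sup>\<star> * x)"
    by (simp add: star_mult star_star mult.assoc)
  also have "\<dots> = 0" using assms by simp
  finally have "(norm (x\<^sup>\<star> * x))\<^sup>2 = 0"
    using cstar_identity[of "x\<^sup>\<star> * x"] by simp
  then show ?thesis using cstar_identity[of x] by simp
qed

text \<open>Only an inequality, because the zero algebra is admitted.\<close>

lemma norm_one_le: "norm (1::'a::unital_cstar_algebra) \<le> 1"
proof -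
  have "norm (1::'a) * norm (1::'a) = norm (1::'a)"
    using cstar_identity[of "1::'a"] by (simp add: power2_eq_square)
  then show ?thesis by (cases "norm (1::'a) = 0") auto
qed

lemma norm_power_le: "norm (x ^ n) \<le> 1" if "norm x \<le> 1" for x :: "'a::unital_cstar_algebra"
proof (induction n)
  case (Suc n)
  have "norm (x * x ^ n) \<le> norm x * norm (x ^ n)" by (rule norm_mult_ineq)
  also have "\<dots> \<le> 1" using mult_mono[OF that Suc] by simp
  finally show ?case by simp
qed (simp add: norm_one_le)

lemma norm_unitary_le: "norm u \<le> 1" if "u\<^sup>\<star> * u = 1" for u :: "'a::unital_cstar_algebra"
proof -
  have "(norm u)\<^sup>2 \<le> 1\<^sup>2" using cstar_identity[of u] norm_one_le[where 'a = 'a] that by simp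
  then show ?thesis by (rule power2_le_imp_le) simp
qed

lemma unitary_power: "(u\<^sup>\<star>) ^ n * u ^ n = 1" if "u\<^sup>\<star> * u = 1" for u :: "'a::unital_cstar_algebra"
proof (induction n)
  case (Suc n)
  have "(u\<^sup>\<star>) ^ Suc n * u ^ Suc n = (u\<^sup>\<star>) ^ n * (u\<^sup>\<star> * u) * u ^ n"
    by (simp only: power_Suc2[of "u\<^sup>\<star>" n] power_Suc[of u n] mult.assoc)
  then show ?case using Suc that by simp
qed simp

lemma cartesian_decomposition:
  fixes a :: "'a::unital_cstar_algebra"
  obtains x y where "x\<^sup>\<star> = x" "y\<^sup>\<star> = y" "a = x + \<i> *\<^sub>C y"
proof
  let ?x = "(1/2::complex) *\<^sub>C (a + a\<^sup>\<star>)" and ?y = "(-\<i>/2) *\<^sub>C (a + (-1) *\<^sub>C a\<^sup>\<star>)"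
  show "?x\<^sup>\<star> = ?x" by (simp add: star_scaleC star_add star_star add.commute)
  show "?y\<^sup>\<star> = ?y"
    by (simp add: star_scaleC star_add star_star scaleC_add_right scaleC_scaleC add.commute)
  have "a = (1/2 + 1/2 :: complex) *\<^sub>C a + (1/2 - 1/2 :: complex) *\<^sub>C a\<^sup>\<star>"
    using scaleC_of_real[of 1 a] scaleC_of_real[of 0 "a\<^sup>\<star>"] by simp
  also have "\<dots> = ?x + \<i> *\<^sub>C ?y"
    by (simp only: diff_conv_add_uminus scaleC_add_left scaleC_add_right scaleC_scaleC)
      (simp add: add_ac)
  finally show "a = ?x + \<i> *\<^sub>C ?y" .
qed

text \<open>Writing \<open>s = 1 - y\<close> turns \<open>s\<^sup>2 = 1 - x\<close> into the fixed point equation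
\<open>y = (x + y\<^sup>2) / 2\<close>. On the ball of radius \<open>\<rho> = 1 - sqrt (1 - norm x)\<close>, the smaller root of
the scalar equation \<open>\<rho> = (norm x + \<rho>\<^sup>2) / 2\<close>, the right hand side is a self-map and contracts
by the factor \<open>\<rho> < 1\<close>. Restricting it to the closed set of self-adjoint elements that commute
with the commutant of \<open>x\<close> yields the extra properties of \<open>s\<close>.\<close>

lemma selfadjoint_sqrt:
  fixes x :: "'a::unital_cstar_algebra"
  assumes "x\<^sup>\<star> = x" "norm x < 1"
  obtains s where "s\<^sup>\<star> = s" "s * s = 1 - x" "\<And>b. b * x = x * b \<Longrightarrow> s * b = b * s"
proof -
  define r where "r = norm x"
  define \<rho> where "\<rho> = 1 - sqrt (1 - r)"
  have r: "0 \<le> r" "r < 1" using assms by (auto simp: r_def)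
  have \<rho>: "0 \<le> \<rho>" "\<rho> < 1" using r by (auto simp: \<rho>_def)
  have "r + (1 - w) * (1 - w) = 2 * (1 - w)" if "w * w = 1 - r" for w
    using that by (simp add: algebra_simps)
  then have quad: "r + \<rho> * \<rho> = 2 * \<rho>" using r by (simp add: \<rho>_def)
  define f :: "'a \<Rightarrow> 'a" where "f y = (1/2) *\<^sub>R (x + y * y)" for y
  define S where "S = {y::'a. norm y \<le> \<rho> \<and> y\<^sup>\<star> = y \<and> (\<forall>b. b * x = x * b \<longrightarrow> y * b = b * y)}"
  have cstar: "continuous_on UNIV (star :: 'a \<Rightarrow> 'a)"
    by (rule linear_continuous_on[OF bounded_linear_star])
  define N where "N = {y::'a. norm y \<le> \<rho>}"
  define H where "H = {y::'a. y\<^sup>\<star> = y}"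
  define K where "K = (\<Inter>b\<in>{b. b * x = x * b}. {y::'a. y * b = b * y})"
  have "closed N" unfolding N_def
    by (intro closed_Collect_le continuous_on_norm continuous_on_id continuous_on_const)
  moreover have "closed H" unfolding H_def
    by (intro closed_Collect_eq cstar continuous_on_id)
  moreover have "closed K" unfolding K_def
  proof (intro closed_INT ballI)
    show "closed {y::'a. y * b = b * y}" for b
      by (rule closed_Collect_eq) (intro continuous_on_mult continuous_on_id continuous_on_const)+
  qed
  moreover have "S = N \<inter> (H \<inter> K)"
  proof (rule set_eqI)
    show "y \<in> S \<longleftrightarrow> y \<in> N \<inter> (H \<inter> K)" for y
      unfolding S_def N_def H_def K_def by blast
  qed
  ultimately have "closed S" by (simp only: closed_Int)
  then have "complete S" by (simp add: complete_eq_closed)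
  moreover
  have S_bound: "norm y \<le> \<rho>" and S_star: "y\<^sup>\<star> = y" if "y \<in> S" for y
    using that unfolding S_def by blast+
  have S_comm: "y * b = b * y" if "y \<in> S" "b * x = x * b" for y b
    using that unfolding S_def by blast
  have S_I: "y \<in> S" if "norm y \<le> \<rho>" "y\<^sup>\<star> = y" "\<And>b. b * x = x * b \<Longrightarrow> y * b = b * y" for y
    using that unfolding S_def by blast
  have "0 \<in> S" by (rule S_I) (simp_all add: \<rho>)
  then have "S \<noteq> {}" by blast
  moreover have "f ` S \<subseteq> S"
  proof
    fix z assume "z \<in> f ` S"
    then obtain y where y: "y \<in> S" and z: "z = f y" by blast
    have "norm y * norm y \<le> \<rho> * \<rho>" by (intro mult_mono S_bound y \<rho> norm_ge_zero)
    then have "norm (y * y) \<le> \<rho> * \<rho>" using norm_mult_ineq order.trans by blast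
    then have "norm (x + y * y) \<le> 2 * \<rho>"
      unfolding quad[symmetric] r_def by (intro norm_triangle_mono order.refl)
    then have "norm z \<le> \<rho>" by (simp add: z f_def)
    moreover have "z\<^sup>\<star> = z"
      by (simp add: z f_def star_scaleR star_add star_mult S_star[OF y] assms(1))
    moreover have "z * b = b * z" if b: "b * x = x * b" for b
    proof -
      have "y * y * b = b * (y * y)" by (metis S_comm[OF y b] mult.assoc)
      then show ?thesis using b by (simp add: z f_def distrib_left distrib_right)
    qed
    ultimately show "z \<in> S" by (rule S_I)
  qed
  moreover have "dist (f y) (f z) \<le> \<rho> * dist y z" if yz: "y \<in> S" "z \<in> S" for y z
  proof -
    have "norm (y * (y - z) + (y - z) * z) \<le> norm y * norm (y - z) + norm (y - z) * norm z"
      by (intro norm_triangle_mono norm_mult_ineq)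
    also have "\<dots> \<le> \<rho> * norm (y - z) + norm (y - z) * \<rho>"
      by (intro add_mono mult_mono S_bound yz \<rho> norm_ge_zero order.refl)
    finally have *: "norm (y * (y - z) + (y - z) * z) \<le> 2 * (\<rho> * norm (y - z))" by simp
    have "f y - f z = (1/2) *\<^sub>R (y * (y - z) + (y - z) * z)"
      by (simp add: f_def algebra_simps)
    then show ?thesis using * by (simp add: dist_norm)
  qed
  ultimately obtain y where y: "y \<in> S" "f y = y"
    using Banach_fix[of S \<rho> f] \<rho> by blast
  show ?thesis
  proof
    have "x + y * y = 2 *\<^sub>R y"
      using arg_cong[OF y(2), of "\<lambda>v. 2 *\<^sub>R v"] by (simp add: f_def)
    then show "(1 - y) * (1 - y) = 1 - x" by (simp add: algebra_simps scaleR_2)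
    show "(1 - y)\<^sup>\<star> = 1 - y" by (simp add: star_diff S_star[OF y(1)])
    show "(1 - y) * b = b * (1 - y)" if "b * x = x * b" for b
      using S_comm[OF y(1) that] by (simp add: algebra_simps)
  qed
qed

text \<open>The operator form of \<open>b = cos \<theta>\<close>: take \<open>u = b + \<i> sqrt (1 - b\<^sup>2)\<close>. All unitaries
used later arise in this way.\<close>

lemma selfadjoint_contraction_real_part_of_unitary:
  fixes b :: "'a::unital_cstar_algebra"
  assumes b: "b\<^sup>\<star> = b" "norm b < 1"
  obtains u where "u\<^sup>\<star> * u = 1" "u * u\<^sup>\<star> = 1" "b = (1/2) *\<^sub>R (u + u\<^sup>\<star>)"
proof -
  have "norm (b * b) < 1"
    using norm_mult_ineq[of b b] mult_strict_mono[OF b(2) b(2)] by simp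
  moreover have "(b * b)\<^sup>\<star> = b * b" using b by (simp add: star_mult)
  ultimately obtain s where s: "s\<^sup>\<star> = s" "s * s = 1 - b * b"
    and comm: "\<And>c. c * (b * b) = b * b * c \<Longrightarrow> s * c = c * s"
    using selfadjoint_sqrt by metis
  have sb: "s * b = b * s" using comm[of b] by (simp add: mult.assoc)
  have neg: "(- \<i>) *\<^sub>C x = - (\<i> *\<^sub>C x)" for x :: 'a
  proof -
    have "(- \<i>) *\<^sub>C x + \<i> *\<^sub>C x = (0::complex) *\<^sub>C x" by (simp flip: scaleC_add_left)
    then show ?thesis using scaleC_of_real[of 0 x] by (simp add: eq_neg_iff_add_eq_0)
  qed
  have ii: "\<i> *\<^sub>C \<i> *\<^sub>C x = - x" for x :: 'a
    using scaleC_of_real[of "-1" x] by (simp add: scaleC_scaleC)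
  have dist: "\<i> *\<^sub>C (x - y) = \<i> *\<^sub>C x - \<i> *\<^sub>C y" for x y :: 'a
    using scaleC_add_right[of \<i> "x - y" y] by simp
  define u where "u = b + \<i> *\<^sub>C s"
  have us: "u\<^sup>\<star> = b - \<i> *\<^sub>C s" using b s by (simp add: u_def star_add star_scaleC neg)
  show ?thesis
  proof
    show "u\<^sup>\<star> * u = 1" unfolding us unfolding u_def using sb s
      by (simp add: algebra_simps mult_scaleC_left mult_scaleC_right dist ii scaleC_add_right)
    show "u * u\<^sup>\<star> = 1" unfolding us unfolding u_def using sb s
      by (simp add: algebra_simps mult_scaleC_left mult_scaleC_right dist ii scaleC_add_right)
    show "b = (1/2) *\<^sub>R (u + u\<^sup>\<star>)" unfolding us unfolding u_def by (simp flip: scaleR_2)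
  qed
qed

lemma contraction_scaling:
  fixes b :: "'a::real_normed_vector"
  obtains r :: real where "r \<noteq> 0" "norm (r *\<^sub>R b) < 1"
proof
  have "0 < norm b + 1" by (simp add: add_nonneg_pos)
  then show "inverse (norm b + 1) \<noteq> 0" "norm (inverse (norm b + 1) *\<^sub>R b) < 1"
    by (simp_all add: inverse_eq_divide pos_divide_less_eq)
qed

section \<open>Polynomials in a self-adjoint contraction\<close>

definition poly_at :: "real poly \<Rightarrow> 'a \<Rightarrow> 'a::unital_cstar_algebra"
  where "poly_at p x = (\<Sum>i\<le>degree p. coeff p i *\<^sub>R x ^ i)"

lemma poly_at_altdef: "degree p \<le> n \<Longrightarrow> poly_at p x = (\<Sum>i\<le>n. coeff p i *\<^sub>R x ^ i)"
  unfolding poly_at_def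
  by (rule sum.mono_neutral_left) (auto simp: coeff_eq_0 not_le)

lemma poly_at_add: "poly_at (p + q) x = poly_at p x + poly_at q x"
proof -
  let ?n = "max (degree p) (degree q)"
  show ?thesis
    using poly_at_altdef[of p ?n x] poly_at_altdef[of q ?n x] poly_at_altdef[of "p + q" ?n x]
    by (simp add: degree_add_le scaleR_add_left sum.distrib)
qed

lemma poly_at_smult: "poly_at (smult c p) x = c *\<^sub>R poly_at p x"
  using poly_at_altdef[of "smult c p" "degree p" x]
  by (simp add: poly_at_def scaleR_sum_right degree_smult_le)

lemma poly_at_0 [simp]: "poly_at 0 x = 0"
  by (simp add: poly_at_def)

lemma poly_at_1 [simp]: "poly_at 1 x = 1"
  by (simp add: poly_at_def)

lemma poly_at_diff: "poly_at (p - q) x = poly_at p x - poly_at q x"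
  using poly_at_add[of "p - q" q x] by simp

lemma poly_at_pCons: "poly_at (pCons c p) x = c *\<^sub>R 1 + x * poly_at p x"
proof -
  have "poly_at (pCons c p) x = (\<Sum>i\<le>Suc (degree p). coeff (pCons c p) i *\<^sub>R x ^ i)"
    by (rule poly_at_altdef) (rule degree_pCons_le)
  also have "\<dots> = c *\<^sub>R 1 + (\<Sum>i\<le>degree p. coeff p i *\<^sub>R (x * x ^ i))"
    by (subst sum.atMost_Suc_shift) simp
  finally show ?thesis by (simp add: poly_at_def sum_distrib_left)
qed

lemma poly_at_mult: "poly_at (p * q) x = poly_at p x * poly_at q x"
proof (induction p)
  case (pCons c p)
  have "poly_at (pCons c p * q) x = poly_at (smult c q) x + poly_at (pCons 0 (p * q)) x"
    by (simp add: poly_at_add)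
  then show ?case
    by (simp add: poly_at_smult poly_at_pCons pCons.IH distrib_right mult.assoc)
qed simp

lemma poly_at_power: "poly_at (p ^ n) x = poly_at p x ^ n"
  by (induction n) (simp_all add: poly_at_mult)

lemma poly_at_sum: "poly_at (\<Sum>i\<in>I. p i) x = (\<Sum>i\<in>I. poly_at (p i) x)"
  by (induction I rule: infinite_finite_induct) (simp_all add: poly_at_add)

lemma poly_at_monom: "poly_at (monom c n) x = c *\<^sub>R x ^ n"
  by (induction n) (simp_all add: monom_0 monom_Suc poly_at_pCons)

lemma star_power: "(x ^ n)\<^sup>\<star> = (x\<^sup>\<star>) ^ n" for x :: "'a::unital_cstar_algebra"
  by (induction n) (simp_all add: star_mult power_commutes)

lemma star_sum: "(\<Sum>i\<in>I. f i)\<^sup>\<star> = (\<Sum>i\<in>I. (f i)\<^sup>\<star>)" for f :: "_ \<Rightarrow> 'a::unital_cstar_algebra"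
  by (induction I rule: infinite_finite_induct) (simp_all add: star_add)

lemma star_poly_at: "(poly_at p x)\<^sup>\<star> = poly_at p (x\<^sup>\<star>)"
  by (simp add: poly_at_def star_sum star_scaleR star_power)

lemma norm_selfadjoint_power:
  fixes x :: "'a::unital_cstar_algebra"
  assumes "x\<^sup>\<star> = x"
  shows "norm (x ^ 2 ^ k) = norm x ^ 2 ^ k"
proof (induction k)
  case (Suc k)
  have "x ^ 2 ^ Suc k = (x ^ 2 ^ k)\<^sup>\<star> * x ^ 2 ^ k"
    using assms by (simp add: star_power flip: power_add mult_2)
  then show ?case
    using Suc by (simp add: cstar_identity flip: power_mult) (simp add: mult.commute)
qed simp

text \<open>Cauchy's estimate at the origin.\<close>

lemma norm_coeff_le_sup_circle:
  fixes p :: "complex poly"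
  assumes "\<And>z. norm z = 1 \<Longrightarrow> norm (poly p z) \<le> B"
  shows "norm (coeff p n) \<le> B"
proof -
  have deriv_n: "(deriv ^^ n) (poly p) = poly ((pderiv ^^ n) p)"
  proof (induction n)
    case (Suc n)
    show ?case by (simp add: Suc fun_eq_iff DERIV_imp_deriv[OF poly_DERIV])
  qed simp
  have "norm ((deriv ^^ n) (poly p) 0) \<le> fact n * B / 1 ^ n"
    by (rule Cauchy_inequality) (auto intro: assms holomorphic_intros continuous_on_poly continuous_on_id)
  moreover have "(deriv ^^ n) (poly p) 0 = fact n * coeff p n"
    by (simp add: deriv_n poly_0_coeff_0 coeff_higher_pderiv pochhammer_fact)
  ultimately show ?thesis by (simp add: norm_mult)
qed

lemma map_poly_of_real_sum:
  "map_poly complex_of_real (\<Sum>i\<in>I. p i) = (\<Sum>i\<in>I. map_poly complex_of_real (p i))"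
  by (rule poly_eqI) (simp add: coeff_map_poly coeff_sum)

lemma map_poly_of_real_mult:
  "map_poly complex_of_real (p * q) = map_poly complex_of_real p * map_poly complex_of_real q"
  by (rule poly_eqI) (simp add: coeff_map_poly coeff_mult)

text \<open>The substitution \<open>t = (z + 1/z) / 2\<close>: multiplication by \<open>z ^ m\<close> clears the denominators, so
that \<open>z ^ m p(t)\<close> is an ordinary polynomial in \<open>z\<close>. The identity is used twice with the
same \<open>q\<close>, in the algebra at a unitary and in the complex plane on the unit circle.\<close>

lemma trigonometric_substitution:
  fixes p :: "real poly"
  assumes "degree p \<le> m"
  obtains q :: "real poly" where "degree q \<le> 2 * m"
    "\<And>(u :: 'a::unital_cstar_algebra) v. u * v = 1 \<Longrightarrow> v * u = 1 \<Longrightarrow>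
        u ^ m * poly_at p ((1/2) *\<^sub>R (u + v)) = poly_at q u"
    "\<And>z. norm z = 1 \<Longrightarrow> poly (map_poly complex_of_real q) z = z ^ m * of_real (poly p (Re z))"
proof -
  define q where "q = (\<Sum>k\<le>m. smult (coeff p k) (monom 1 (m - k) * [:1/2, 0, 1/2:] ^ k))"
  show ?thesis
  proof
    show "degree q \<le> 2 * m" unfolding q_def
    proof (intro degree_sum_le)
      fix k assume k: "k \<in> {..m}"
      have "degree (monom (1::real) (m - k) * [:1/2, 0, 1/2:] ^ k)
          \<le> (m - k) + degree ([:1/2, 0, 1/2::real:]) * k"
        by (intro order.trans[OF degree_mult_le] add_mono degree_monom_le degree_power_le)
      also have "\<dots> \<le> 2 * m" using k by simp
      finally show "degree (smult (coeff p k) (monom 1 (m - k) * [:1/2, 0, 1/2:] ^ k)) \<le> 2 * m"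
        using degree_smult_le order.trans by blast
    qed simp
  next
    fix u v :: 'a assume uv: "u * v = 1" "v * u = 1"
    define b where "b = (1/2) *\<^sub>R (u + v)"
    have "u * b = (1/2) *\<^sub>R 1 + (1/2) *\<^sub>R (u * u)"
      using uv by (simp add: b_def algebra_simps)
    then have ub: "poly_at [:1/2, 0, 1/2:] u = u * b"
      by (simp add: poly_at_pCons)
    have comm: "u * b = b * u" using uv by (simp add: b_def algebra_simps)
    have pow: "(u * b) ^ k = u ^ k * b ^ k" for k
    proof (induction k)
      case (Suc k)
      have "u * b * (u ^ k * b ^ k) = u * (b * u ^ k) * b ^ k" by (simp add: mult.assoc)
      also have "b * u ^ k = u ^ k * b" using power_commuting_commutes[OF comm[symmetric], symmetric]
        using power_commuting_commutes[of b u k] power_commuting_commutes[of u b k] comm by metis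
      finally show ?case using Suc by (simp add: mult.assoc)
    qed simp
    have "u ^ m * poly_at p b = (\<Sum>k\<le>m. coeff p k *\<^sub>R (u ^ m * b ^ k))"
      by (simp add: poly_at_altdef[OF assms] sum_distrib_left)
    also have "\<dots> = (\<Sum>k\<le>m. coeff p k *\<^sub>R (u ^ (m - k) * (u ^ k * b ^ k)))"
      by (intro sum.cong) (simp_all flip: mult.assoc power_add)
    also have "\<dots> = poly_at q u"
      by (simp add: q_def poly_at_sum poly_at_smult poly_at_mult poly_at_monom poly_at_power ub pow)
    finally show "u ^ m * poly_at p ((1/2) *\<^sub>R (u + v)) = poly_at q u" by (simp add: b_def)
  next
    fix z :: complex assume z: "norm z = 1"
    have zz: "z * cnj z = 1" using z by (simp add: complex_norm_square[symmetric])
    have "1/2 + z * z * (1/2) = z * of_real (Re z)"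
    proof -
      have "z * of_real (Re z) = z * ((z + cnj z) / 2)" by (simp add: complex_add_cnj)
      also have "\<dots> = (z * z + z * cnj z) / 2" by (simp add: algebra_simps)
      finally show ?thesis by (simp add: zz add_divide_distrib)
    qed
    then have pt: "poly (map_poly complex_of_real [:1/2, 0, 1/2:]) z = z * of_real (Re z)"
      by (simp add: map_poly_pCons mult.assoc)
    have polyval: "poly p t = (\<Sum>k\<le>m. coeff p k * t ^ k)" for t
      unfolding poly_altdef using assms
      by (intro sum.mono_neutral_left) (auto simp: coeff_eq_0 not_le)
    have pow: "poly (map_poly complex_of_real ([:1/2, 0, 1/2:] ^ k)) z = (z * of_real (Re z)) ^ k" for k
      by (induction k) (simp_all only: power_0 power_Suc map_poly_of_real_mult poly_mult pt
          map_poly_1' of_real_1 poly_1)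
    have "poly (map_poly complex_of_real q) z
        = (\<Sum>k\<le>m. of_real (coeff p k) * (z ^ (m - k) * (z * of_real (Re z)) ^ k))"
      unfolding q_def
      by (simp add: map_poly_of_real_sum map_poly_of_real_mult map_poly_smult map_poly_monom
          poly_sum poly_monom pow)
    also have "\<dots> = (\<Sum>k\<le>m. z ^ m * of_real (coeff p k * Re z ^ k))"
    proof (intro sum.cong refl)
      fix k assume "k \<in> {..m}"
      then have "z ^ m = z ^ (m - k) * z ^ k" by (simp flip: power_add)
      then show "of_real (coeff p k) * (z ^ (m - k) * (z * of_real (Re z)) ^ k)
          = z ^ m * of_real (coeff p k * Re z ^ k)"
        by (simp add: power_mult_distrib)
    qed
    also have "\<dots> = z ^ m * of_real (poly p (Re z))"
      by (simp add: polyval sum_distrib_left)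
    finally show "poly (map_poly complex_of_real q) z = z ^ m * of_real (poly p (Re z))" .
  qed
qed

lemma le_one_if_powers_linear:
  fixes r C :: real
  assumes "\<And>k::nat. r ^ 2 ^ k \<le> C * 2 ^ k + 1"
  shows "r \<le> 1"
proof (rule ccontr)
  assume "\<not> r \<le> 1"
  then have r: "1 < r" by simp
  have "(\<lambda>n. real n / r ^ n) \<longlonglongrightarrow> 0"
    using powser_times_n_limit_0[of "1/r"] r by (simp add: power_divide abs_if)
  moreover have "(\<lambda>n. (1/r) ^ n) \<longlonglongrightarrow> 0"
    by (rule LIMSEQ_power_zero) (use r in \<open>simp add: abs_if\<close>)
  ultimately have "(\<lambda>n. C * (real n / r ^ n) + (1/r) ^ n) \<longlonglongrightarrow> C * 0 + 0"
    by (intro tendsto_add tendsto_mult tendsto_const)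
  moreover have "filterlim (\<lambda>k::nat. 2 ^ k :: nat) sequentially sequentially"
    by (rule filterlim_subseq) (simp add: strict_mono_def)
  ultimately have "(\<lambda>k. C * (real (2 ^ k) / r ^ 2 ^ k) + (1/r) ^ 2 ^ k) \<longlonglongrightarrow> 0"
    using filterlim_compose by fastforce
  moreover have "1 \<le> C * (real (2 ^ k) / r ^ 2 ^ k) + (1/r) ^ 2 ^ k" for k
    using assms[of k] r by (simp add: field_simps)
  ultimately have "(1::real) \<le> 0" by (intro LIMSEQ_le_const) auto
  then show False by simp
qed

text \<open>Since \<open>x = p(b)\<close> is self-adjoint, \<open>norm x ^ n = norm (x ^ n)\<close> for \<open>n = 2 ^ k\<close>. Writing
\<open>b\<close> as the real part of a unitary \<open>u\<close> makes \<open>x ^ n\<close> a trigonometric polynomial in \<open>u\<close> with at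
most \<open>2 n degree p + 1\<close> terms whose coefficients are bounded by \<open>M ^ n\<close>. So \<open>(norm x / M) ^ n\<close>
grows at most linearly in \<open>n\<close>, which forces \<open>norm x \<le> M\<close>.\<close>

theorem norm_poly_at_le:
  fixes b :: "'a::unital_cstar_algebra"
  assumes b: "b\<^sup>\<star> = b" "norm b < 1"
    and le: "\<And>t. \<bar>t\<bar> \<le> 1 \<Longrightarrow> \<bar>poly p t\<bar> \<le> M"
  shows "norm (poly_at p b) \<le> M"
proof -
  obtain u where u: "u\<^sup>\<star> * u = 1" "u * u\<^sup>\<star> = 1" "b = (1/2) *\<^sub>R (u + u\<^sup>\<star>)"
    using selfadjoint_contraction_real_part_of_unitary[OF b] .
  \<comment> \<open>The bound is proved for every \<open>M' > M\<close>, so that one can divide by \<open>M'\<close> even if \<open>M = 0\<close>.\<close>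
  have growth: "norm (poly_at p b) ^ 2 ^ k \<le> (real (2 * degree p) * 2 ^ k + 1) * M' ^ 2 ^ k"
    if M': "M \<le> M'" for k M'
  proof -
    let ?n = "2 ^ k :: nat"
    have "M' \<ge> 0" using le[of 0] M' by linarith
    define m where "m = degree p * ?n"
    have "degree (p ^ ?n) \<le> m" unfolding m_def by (rule degree_power_le)
    then obtain q :: "real poly" where q: "degree q \<le> 2 * m"
      "\<And>u v::'a. u * v = 1 \<Longrightarrow> v * u = 1 \<Longrightarrow>
        u ^ m * poly_at (p ^ ?n) ((1/2) *\<^sub>R (u + v)) = poly_at q u"
      "\<And>z. norm z = 1 \<Longrightarrow>
        poly (map_poly complex_of_real q) z = z ^ m * of_real (poly (p ^ ?n) (Re z))"
      using trigonometric_substitution by metis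
    have "norm (poly (map_poly complex_of_real q) z) \<le> M' ^ ?n" if z: "norm z = 1" for z
    proof -
      have "\<bar>Re z\<bar> \<le> 1" using abs_Re_le_cmod[of z] z by simp
      then have "\<bar>poly p (Re z)\<bar> ^ ?n \<le> M' ^ ?n" using le M' by (intro power_mono) fastforce+
      then show ?thesis using z
        by (simp add: q(3) norm_mult norm_power power_abs)
    qed
    then have c: "\<bar>coeff q i\<bar> \<le> M' ^ ?n" for i
      using norm_coeff_le_sup_circle[of "map_poly complex_of_real q" "M' ^ ?n" i]
      by (simp add: coeff_map_poly)
    have "poly_at (p ^ ?n) b = (u\<^sup>\<star>) ^ m * poly_at q u"
      using q(2)[OF u(2,1)] u(3) unitary_power[OF u(1), of m] by (metis mult.assoc mult_1)
    then have "norm (poly_at (p ^ ?n) b) \<le> norm ((u\<^sup>\<star>) ^ m) * norm (poly_at q u)"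
      using norm_mult_ineq by metis
    also have "\<dots> \<le> 1 * norm (poly_at q u)"
      using norm_power_le[of "u\<^sup>\<star>" m] norm_unitary_le[OF u(1)] by (intro mult_right_mono) auto
    also have "\<dots> \<le> (\<Sum>i\<le>2 * m. norm (coeff q i *\<^sub>R u ^ i))"
      unfolding poly_at_altdef[OF q(1), of u] mult_1 by (rule norm_sum)
    also have "\<dots> \<le> (\<Sum>i\<le>2 * m. M' ^ ?n * 1)"
      unfolding norm_scaleR using norm_power_le[OF norm_unitary_le[OF u(1)]] c \<open>M' \<ge> 0\<close>
      by (intro sum_mono mult_mono) auto
    also have "\<dots> = (real (2 * degree p) * 2 ^ k + 1) * M' ^ ?n"
      by (simp add: m_def algebra_simps)
    finally show ?thesis
      by (simp add: poly_at_power norm_selfadjoint_power star_poly_at b)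
  qed
  have "norm (poly_at p b) \<le> M'" if M': "M < M'" for M'
  proof -
    have "0 < M'" using le[of 0] M' by linarith
    have "norm (poly_at p b) / M' \<le> 1"
    proof (rule le_one_if_powers_linear)
      fix k :: nat
      show "(norm (poly_at p b) / M') ^ 2 ^ k \<le> real (2 * degree p) * 2 ^ k + 1"
        using growth[of M' k] M' \<open>0 < M'\<close> by (simp add: power_divide field_simps)
    qed
    then show ?thesis using \<open>0 < M'\<close> by simp
  qed
  then show ?thesis using dense_ge by blast
qed

section \<open>Continuous functional calculus\<close>

lemma continuous_bounded_on_unit_interval:
  fixes f :: "real \<Rightarrow> real"
  assumes "continuous_on {-1..1} f"
  shows "\<exists>A. \<forall>t. \<bar>t\<bar> \<le> 1 \<longrightarrow> \<bar>f t\<bar> \<le> A"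
proof -
  obtain A where A: "\<And>t. t \<in> {-1..1} \<Longrightarrow> \<bar>f t\<bar> \<le> A"
    using compact_imp_bounded[OF compact_continuous_image[OF assms compact_Icc]]
    unfolding bounded_iff by (metis image_eqI real_norm_def)
  then show ?thesis by (metis abs_le_iff atLeastAtMost_iff minus_le_iff)
qed

lemma weierstrass_poly:
  fixes f :: "real \<Rightarrow> real"
  assumes "continuous_on {-1..1} f" "0 < e"
  obtains p :: "real poly" where "\<And>t. \<bar>t\<bar> \<le> 1 \<Longrightarrow> \<bar>f t - poly p t\<bar> \<le> e"
proof -
  obtain g where g: "real_polynomial_function g" "\<And>t. t \<in> {-1..1} \<Longrightarrow> \<bar>f t - g t\<bar> < e"
    using Stone_Weierstrass_real_polynomial_function[OF compact_Icc assms] by blast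
  then obtain a n where an: "g = (\<lambda>t. \<Sum>i\<le>n. a i * t ^ i)"
    by (auto simp: real_polynomial_function_iff_sum)
  have "poly (\<Sum>i\<le>n. monom (a i) i) t = g t" for t
    by (simp add: an poly_sum poly_monom)
  with g(2) that[of "\<Sum>i\<le>n. monom (a i) i"] show ?thesis
    by (force simp: abs_le_iff)
qed

lemma weierstrass_poly_sequence:
  fixes f :: "real \<Rightarrow> real"
  assumes f: "continuous_on {-1..1} f"
  obtains P :: "nat \<Rightarrow> real poly"
  where "\<And>n t. \<bar>t\<bar> \<le> 1 \<Longrightarrow> \<bar>f t - poly (P n) t\<bar> \<le> 1 / real (Suc n)"
proof -
  have "\<exists>p. \<forall>t. \<bar>t\<bar> \<le> 1 \<longrightarrow> \<bar>f t - poly p t\<bar> \<le> 1 / real (Suc n)" for n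
    using weierstrass_poly[OF f, of "1 / real (Suc n)"] by auto
  then show ?thesis using that by metis
qed

text \<open>The element \<open>F f\<close> is the limit of \<open>p(b)\<close> over polynomials \<open>p\<close> that converge to \<open>f\<close>
uniformly on \<open>[-1, 1]\<close>; the norm bound for polynomials gives both the convergence and the
independence of the choice. The stated estimate characterises \<open>F f\<close>, and all algebraic rules
for \<open>F\<close> follow from it.\<close>

theorem functional_calculus:
  fixes b :: "'a::unital_cstar_algebra"
  assumes b: "b\<^sup>\<star> = b" "norm b < 1"
  obtains F :: "(real \<Rightarrow> real) \<Rightarrow> 'a" where
    "\<And>p f e. continuous_on {-1..1} f \<Longrightarrow> (\<And>t. \<bar>t\<bar> \<le> 1 \<Longrightarrow> \<bar>f t - poly p t\<bar> \<le> e) \<Longrightarrow>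
        norm (F f - poly_at p b) \<le> e"
proof -
  have "\<exists>x. \<forall>p e. (\<forall>t. \<bar>t\<bar> \<le> 1 \<longrightarrow> \<bar>f t - poly p t\<bar> \<le> e) \<longrightarrow> norm (x - poly_at p b) \<le> e"
    if f: "continuous_on {-1..1} f" for f
  proof -
    obtain P where P: "\<And>n t. \<bar>t\<bar> \<le> 1 \<Longrightarrow> \<bar>f t - poly (P n) t\<bar> \<le> 1 / real (Suc n)"
      using weierstrass_poly_sequence[OF f] by blast
    have near: "norm (poly_at (P n) b - poly_at p b) \<le> 1 / real (Suc n) + e"
      if p: "\<And>t. \<bar>t\<bar> \<le> 1 \<Longrightarrow> \<bar>f t - poly p t\<bar> \<le> e" for n p e
    proof -
      have "norm (poly_at (P n - p) b) \<le> 1 / real (Suc n) + e"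
      proof (rule norm_poly_at_le[OF b])
        fix t :: real assume "\<bar>t\<bar> \<le> 1"
        then show "\<bar>poly (P n - p) t\<bar> \<le> 1 / real (Suc n) + e"
          using P[of t n] p[of t] by simp
      qed
      then show ?thesis by (simp add: poly_at_diff)
    qed
    have "Cauchy (\<lambda>n. poly_at (P n) b)"
    proof (rule metric_CauchyI)
      fix e :: real assume "0 < e"
      then obtain N where N: "1 / real (Suc N) < e / 2"
        using nat_approx_posE[of "e / 2"] by auto
      have "dist (poly_at (P m) b) (poly_at (P n) b) < e" if "N \<le> m" "N \<le> n" for m n
      proof -
        have "1 / real (Suc m) \<le> 1 / real (Suc N)" "1 / real (Suc n) \<le> 1 / real (Suc N)"
          using that by (auto intro!: divide_left_mono)
        then show ?thesis
          using near[of "P n" "1 / real (Suc n)" m] P N by (simp add: dist_norm)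
      qed
      then show "\<exists>M. \<forall>m\<ge>M. \<forall>n\<ge>M. dist (poly_at (P m) b) (poly_at (P n) b) < e" by blast
    qed
    then obtain x where x: "(\<lambda>n. poly_at (P n) b) \<longlonglongrightarrow> x"
      using Cauchy_convergent convergent_def by blast
    have "norm (x - poly_at p b) \<le> e"
      if p: "\<And>t. \<bar>t\<bar> \<le> 1 \<Longrightarrow> \<bar>f t - poly p t\<bar> \<le> e" for p e
    proof (rule LIMSEQ_le)
      show "(\<lambda>n. norm (poly_at (P n) b - poly_at p b)) \<longlonglongrightarrow> norm (x - poly_at p b)"
        using x by (intro tendsto_intros)
      have "(\<lambda>n. 1 / real (Suc n) + e) \<longlonglongrightarrow> 0 + e"
        using LIMSEQ_inverse_real_of_nat by (intro tendsto_add tendsto_const) (simp add: inverse_eq_divide)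
      then show "(\<lambda>n. 1 / real (Suc n) + e) \<longlonglongrightarrow> e" by simp
      show "\<exists>N. \<forall>n\<ge>N. norm (poly_at (P n) b - poly_at p b) \<le> 1 / real (Suc n) + e"
        using near[OF p] by blast
    qed
    then show ?thesis by blast
  qed
  then obtain F where "\<And>f p e. continuous_on {-1..1} f \<Longrightarrow>
      (\<forall>t. \<bar>t\<bar> \<le> 1 \<longrightarrow> \<bar>f t - poly p t\<bar> \<le> e) \<Longrightarrow> norm (F f - poly_at p b) \<le> e"
    by metis
  then show ?thesis using that by blast
qed

locale continuous_functional_calculus =
  fixes b :: "'a::unital_cstar_algebra" and F :: "(real \<Rightarrow> real) \<Rightarrow> 'a"
  assumes near_poly: "\<And>p f e. continuous_on {-1..1} f \<Longrightarrow>
      (\<And>t. \<bar>t\<bar> \<le> 1 \<Longrightarrow> \<bar>f t - poly p t\<bar> \<le> e) \<Longrightarrow> norm (F f - poly_at p b) \<le> e"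
begin

lemma F_poly: "F (poly p) = poly_at p b"
proof -
  have "norm (F (poly p) - poly_at p b) \<le> 0"
    by (rule near_poly) (auto intro!: continuous_on_poly continuous_on_id)
  then show ?thesis by simp
qed

lemma F_one: "F (\<lambda>_. 1) = 1"
proof -
  have "(\<lambda>_. 1) = poly (1 :: real poly)" by (simp add: fun_eq_iff)
  then show ?thesis by (simp only: F_poly poly_at_1)
qed

lemma F_zero: "F (\<lambda>_. 0) = 0"
proof -
  have "(\<lambda>_. 0) = poly (0 :: real poly)" by (simp add: fun_eq_iff)
  then show ?thesis by (simp only: F_poly poly_at_0)
qed

lemma F_id: "F (\<lambda>t. t) = b"
proof -
  have "(\<lambda>t. t) = poly [:0, 1 :: real:]" by (simp add: fun_eq_iff)
  then show ?thesis by (simp only: F_poly) (simp add: poly_at_pCons)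
qed

lemma norm_F_le:
  assumes f: "continuous_on {-1..1} f" and M: "\<And>t. \<bar>t\<bar> \<le> 1 \<Longrightarrow> \<bar>f t\<bar> \<le> M"
  shows "norm (F f) \<le> M"
  using near_poly[of f 0 M] assms by simp

lemma tendsto_F:
  assumes f: "continuous_on {-1..1} f"
    and P: "\<And>n t. \<bar>t\<bar> \<le> 1 \<Longrightarrow> \<bar>f t - poly (P n) t\<bar> \<le> C / real (Suc n)"
  shows "(\<lambda>n. poly_at (P n) b) \<longlonglongrightarrow> F f"
proof -
  have "(\<lambda>n. F f - poly_at (P n) b) \<longlonglongrightarrow> 0"
  proof (rule Lim_null_comparison)
    show "\<forall>\<^sub>F n in sequentially. norm (F f - poly_at (P n) b) \<le> C * inverse (real (Suc n))"
      using near_poly[OF f] P by (simp add: divide_inverse)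
    show "(\<lambda>n. C * inverse (real (Suc n))) \<longlonglongrightarrow> 0"
      using tendsto_mult[OF tendsto_const LIMSEQ_inverse_real_of_nat, of C] by simp
  qed
  then have "(\<lambda>n. F f - (F f - poly_at (P n) b)) \<longlonglongrightarrow> F f - 0"
    by (intro tendsto_diff tendsto_const)
  then show ?thesis by simp
qed

lemma F_add:
  assumes f: "continuous_on {-1..1} f" and g: "continuous_on {-1..1} g"
  shows "F (\<lambda>t. f t + g t) = F f + F g"
proof -
  obtain P where P: "\<And>n t. \<bar>t\<bar> \<le> 1 \<Longrightarrow> \<bar>f t - poly (P n) t\<bar> \<le> 1 / real (Suc n)"
    using weierstrass_poly_sequence[OF f] by blast
  obtain Q where Q: "\<And>n t. \<bar>t\<bar> \<le> 1 \<Longrightarrow> \<bar>g t - poly (Q n) t\<bar> \<le> 1 / real (Suc n)"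
    using weierstrass_poly_sequence[OF g] by blast
  have "(\<lambda>n. poly_at (P n + Q n) b) \<longlonglongrightarrow> F (\<lambda>t. f t + g t)"
  proof (rule tendsto_F)
    show "\<bar>f t + g t - poly (P n + Q n) t\<bar> \<le> 2 / real (Suc n)" if "\<bar>t\<bar> \<le> 1" for n t
    proof -
      have "2 / real (Suc n) = 1 / real (Suc n) + 1 / real (Suc n)" by simp
      then show ?thesis using P[OF that, of n] Q[OF that, of n] unfolding poly_add by linarith
    qed
  qed (intro continuous_on_add f g)
  moreover have "(\<lambda>n. poly_at (P n + Q n) b) \<longlonglongrightarrow> F f + F g"
    unfolding poly_at_add by (rule tendsto_add[OF tendsto_F[OF f P] tendsto_F[OF g Q]])
  ultimately show ?thesis by (rule LIMSEQ_unique)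
qed

lemma F_mult:
  assumes f: "continuous_on {-1..1} f" and g: "continuous_on {-1..1} g"
  shows "F (\<lambda>t. f t * g t) = F f * F g"
proof -
  obtain P where P: "\<And>n t. \<bar>t\<bar> \<le> 1 \<Longrightarrow> \<bar>f t - poly (P n) t\<bar> \<le> 1 / real (Suc n)"
    using weierstrass_poly_sequence[OF f] by blast
  obtain Q where Q: "\<And>n t. \<bar>t\<bar> \<le> 1 \<Longrightarrow> \<bar>g t - poly (Q n) t\<bar> \<le> 1 / real (Suc n)"
    using weierstrass_poly_sequence[OF g] by blast
  obtain A where A: "\<And>t. \<bar>t\<bar> \<le> 1 \<Longrightarrow> \<bar>f t\<bar> \<le> A"
    using continuous_bounded_on_unit_interval[OF f] by blast
  obtain B where B: "\<And>t. \<bar>t\<bar> \<le> 1 \<Longrightarrow> \<bar>g t\<bar> \<le> B"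
    using continuous_bounded_on_unit_interval[OF g] by blast
  have "(\<lambda>n. poly_at (P n * Q n) b) \<longlonglongrightarrow> F (\<lambda>t. f t * g t)"
  proof (rule tendsto_F)
    show "\<bar>f t * g t - poly (P n * Q n) t\<bar> \<le> (A + (B + 1)) / real (Suc n)" if t: "\<bar>t\<bar> \<le> 1" for n t
    proof -
      have "1 / real (Suc n) \<le> 1" by simp
      then have "\<bar>poly (Q n) t\<bar> \<le> B + 1"
        using Q[OF t, of n] B[OF t] by linarith
      then have "\<bar>f t - poly (P n) t\<bar> * \<bar>poly (Q n) t\<bar> \<le> 1 / real (Suc n) * (B + 1)"
        by (intro mult_mono P t) auto
      moreover have "\<bar>f t\<bar> * \<bar>g t - poly (Q n) t\<bar> \<le> A * (1 / real (Suc n))"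
        using A[OF t] by (intro mult_mono Q t) auto
      moreover have "f t * g t - poly (P n * Q n) t
          = f t * (g t - poly (Q n) t) + (f t - poly (P n) t) * poly (Q n) t"
        by (simp add: algebra_simps)
      then have "\<bar>f t * g t - poly (P n * Q n) t\<bar>
          \<le> \<bar>f t\<bar> * \<bar>g t - poly (Q n) t\<bar> + \<bar>f t - poly (P n) t\<bar> * \<bar>poly (Q n) t\<bar>"
        by (simp only: abs_mult[symmetric] abs_triangle_ineq)
      ultimately have "\<bar>f t * g t - poly (P n * Q n) t\<bar>
          \<le> A * (1 / real (Suc n)) + 1 / real (Suc n) * (B + 1)" by linarith
      then show ?thesis by (simp add: add_divide_distrib)
    qed
  qed (intro continuous_on_mult f g)
  moreover have "(\<lambda>n. poly_at (P n * Q n) b) \<longlonglongrightarrow> F f * F g"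
    unfolding poly_at_mult by (rule tendsto_mult[OF tendsto_F[OF f P] tendsto_F[OF g Q]])
  ultimately show ?thesis by (rule LIMSEQ_unique)
qed

lemma F_scale: "continuous_on {-1..1} f \<Longrightarrow> F (\<lambda>t. c * f t) = c *\<^sub>R F f"
proof -
  assume f: "continuous_on {-1..1} f"
  have "F (poly [:c:]) = c *\<^sub>R 1" by (simp add: F_poly poly_at_pCons)
  moreover have "poly [:c:] = (\<lambda>_. c)" by (simp add: fun_eq_iff)
  ultimately have "F (\<lambda>_. c) = c *\<^sub>R 1" by simp
  then show ?thesis using F_mult[OF continuous_on_const f, of c] by simp
qed

end

section \<open>Bilinear maps that vanish on zero products\<close>

lemma cos_two_pi_thirds: "cos (2 * pi / 3) = - 1 / 2"
proof -
  have "cos (2 * pi / 3) = cos (pi - pi / 3)" by (simp add: field_simps)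
  then show ?thesis by (simp only: cos_pi_minus cos_60)
qed

lemma cos_four_pi_thirds: "cos (4 * pi / 3) = - 1 / 2"
proof -
  have "cos (4 * pi / 3) = cos (2 * (2 * pi / 3))" by simp
  then show ?thesis by (simp only: cos_double_cos cos_two_pi_thirds) (simp add: power2_eq_square)
qed

text \<open>For \<open>i = -1, 0, 1\<close> these are translates of a Dirichlet kernel, normalised to have sum \<open>1\<close>.
As a function of \<open>t = N s\<close>, the bump with index \<open>i\<close> has period \<open>1\<close> and vanishes on the two classes
\<open>\<int> + j/3\<close> with \<open>j \<noteq> i\<close>. Therefore any two bumps, equal or not, vanish together on at least
one class: this is why \<open>3\<close> of them are taken.\<close>

definition third_root_bump :: "nat \<Rightarrow> int \<Rightarrow> real \<Rightarrow> real"
  where "third_root_bump N i s = (1 + 2 * cos (2 * pi * (real N * s) - 2 * pi * of_int i / 3)) / 3"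

lemma third_root_bump_sum: "(\<Sum>i\<in>{-1,0,1}. third_root_bump N i s) = 1"
proof -
  let ?x = "2 * pi * (real N * s)"
  have "cos (?x - 2 * pi / 3) + cos (?x + 2 * pi / 3) = - cos ?x"
    by (simp add: cos_add cos_diff cos_two_pi_thirds)
  then have "cos (?x - 2 * pi / 3) = - cos (?x + 2 * pi / 3) - cos ?x" by linarith
  then show ?thesis by (simp add: third_root_bump_def add_divide_distrib diff_divide_distrib)
qed

lemma third_root_bump_bound: "\<bar>third_root_bump N i s\<bar> \<le> 1"
proof -
  have le: "\<bar>(1 + 2 * c) / 3\<bar> \<le> 1" if "\<bar>c\<bar> \<le> 1" for c :: real
    using that by (auto simp: abs_le_iff)
  show ?thesis unfolding third_root_bump_def by (intro le abs_cos_le_one)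
qed

lemma third_root_bump_zero:
  assumes "i \<in> {-1,0,1}" "j \<in> {-1,0,1}" "i \<noteq> j" "0 < N"
  shows "third_root_bump N i ((of_int k + of_int j / 3) / real N) = 0"
proof -
  have "2 * pi * (real N * ((of_int k + of_int j / 3) / real N)) - 2 * pi * of_int i / 3
      = 2 * pi * of_int (j - i) / 3 + of_int k * (2 * pi)"
    using assms(4) by (simp add: field_simps)
  then have "cos (2 * pi * (real N * ((of_int k + of_int j / 3) / real N)) - 2 * pi * of_int i / 3)
      = cos (2 * pi * of_int (j - i) / 3)"
    using cos.plus_of_int[of "2 * pi * of_int (j - i) / 3" k] by simp
  also have "\<dots> = - 1 / 2"
  proof -
    have "j - i \<in> {-2,-1,1,2}" using assms by auto
    then show ?thesis
      using cos_two_pi_thirds cos_four_pi_thirds by (auto simp del: of_int_diff)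
  qed
  finally show ?thesis by (simp add: third_root_bump_def)
qed

lemma continuous_third_root_bump: "continuous_on S (third_root_bump N i)"
  unfolding third_root_bump_def by (intro continuous_intros) auto

text \<open>The normalised number of grid points to the left of \<open>s\<close> is a step function that follows
\<open>s + 2\<close> up to two grid steps. The range of \<open>k\<close> covers \<open>[-1, 1]\<close> with a margin for the
shift \<open>\<theta>\<close>.\<close>

lemma grid_count:
  fixes N :: nat and \<theta> s :: real
  assumes "0 < N" "\<bar>\<theta>\<bar> \<le> 1" "\<bar>s\<bar> \<le> 1"
  shows "\<bar>s + 2 - (\<Sum>k\<in>{-2 * int N..<2 * int N}. if s \<le> (of_int k + \<theta>) / real N then 0 else 1) / real N\<bar>
    \<le> 2 / real N"
proof -
  let ?x = "real N * s - \<theta>"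
  have x: "- 2 * real N \<le> ?x" "?x \<le> 2 * real N"
  proof -
    have "\<bar>real N * s\<bar> \<le> real N * 1" unfolding abs_mult using assms by (intro mult_mono) auto
    moreover have "1 \<le> real N" using assms by simp
    ultimately show "- 2 * real N \<le> ?x" "?x \<le> 2 * real N" using assms(2) by linarith+
  qed
  then have c: "-2 * int N \<le> \<lceil>?x\<rceil>" "\<lceil>?x\<rceil> \<le> 2 * int N"
    by linarith+
  have "(\<not> s \<le> (of_int k + \<theta>) / real N) \<longleftrightarrow> k < \<lceil>?x\<rceil>" for k :: int
    using assms(1) by (simp add: field_simps less_ceiling_iff not_le)
  then have "(\<Sum>k\<in>{-2 * int N..<2 * int N}. if s \<le> (of_int k + \<theta>) / real N then 0 else (1::real))
      = (\<Sum>k\<in>{-2 * int N..<2 * int N}. if k < \<lceil>?x\<rceil> then 1 else 0)"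
    by (intro sum.cong refl) metis
  also have "\<dots> = (\<Sum>k\<in>{k \<in> {-2 * int N..<2 * int N}. k < \<lceil>?x\<rceil>}. 1)"
    by (rule sum.inter_filter[symmetric]) simp
  also have "{k \<in> {-2 * int N..<2 * int N}. k < \<lceil>?x\<rceil>} = {-2 * int N..<\<lceil>?x\<rceil>}"
    using c(2) by auto
  also have "(\<Sum>k\<in>{-2 * int N..<\<lceil>?x\<rceil>}. 1::real) = of_int \<lceil>?x\<rceil> + 2 * real N"
    using c(1) by simp
  finally have count: "(\<Sum>k\<in>{-2 * int N..<2 * int N}. if s \<le> (of_int k + \<theta>) / real N then 0 else (1::real))
      = of_int \<lceil>?x\<rceil> + 2 * real N" .
  have "s + 2 - (of_int \<lceil>?x\<rceil> + 2 * real N) / real N = (real N * s - of_int \<lceil>?x\<rceil>) / real N"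
    using assms(1) by (simp add: field_simps)
  moreover have "\<bar>real N * s - of_int \<lceil>?x\<rceil>\<bar> \<le> 2" using assms(2) by linarith
  ultimately show ?thesis unfolding count by (simp add: divide_right_mono)
qed

abbreviation cont :: "(real \<Rightarrow> real) \<Rightarrow> bool"
  where "cont \<equiv> continuous_on {-1..1}"

text \<open>A bounded bilinear form on \<open>C[-1, 1]\<close>. The elements are functions on the whole line that are
only required to be continuous on \<open>[-1, 1]\<close>, so that explicit formulas can be inserted; accordingly
the supports in the last axiom are disjoint on the whole line, as they are for the cuts below.\<close>

locale disjointness_preserving_form =
  fixes \<psi> :: "(real \<Rightarrow> real) \<Rightarrow> (real \<Rightarrow> real) \<Rightarrow> 'b::real_normed_vector" and K :: real
  assumes add_left: "cont f \<Longrightarrow> cont f' \<Longrightarrow> cont g \<Longrightarrow> \<psi> (\<lambda>s. f s + f' s) g = \<psi> f g + \<psi> f' g"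
    and add_right: "cont f \<Longrightarrow> cont g \<Longrightarrow> cont g' \<Longrightarrow> \<psi> f (\<lambda>s. g s + g' s) = \<psi> f g + \<psi> f g'"
    and scale_left: "cont f \<Longrightarrow> cont g \<Longrightarrow> \<psi> (\<lambda>s. c * f s) g = c *\<^sub>R \<psi> f g"
    and scale_right: "cont f \<Longrightarrow> cont g \<Longrightarrow> \<psi> f (\<lambda>s. c * g s) = c *\<^sub>R \<psi> f g"
    and bound: "cont f \<Longrightarrow> cont g \<Longrightarrow> (\<And>t. \<bar>t\<bar> \<le> 1 \<Longrightarrow> \<bar>f t\<bar> \<le> M) \<Longrightarrow> (\<And>t. \<bar>t\<bar> \<le> 1 \<Longrightarrow> \<bar>g t\<bar> \<le> M')
        \<Longrightarrow> norm (\<psi> f g) \<le> K * (M * M')"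
    and disjoint: "cont f \<Longrightarrow> cont g \<Longrightarrow> (\<And>t. f t * g t = 0) \<Longrightarrow> \<psi> f g = 0"
begin

lemma swap: "disjointness_preserving_form (\<lambda>f g. \<psi> g f) K"
proof
  show "norm (\<psi> g f) \<le> K * (M * M')"
    if "cont f" "cont g" "\<And>t. \<bar>t\<bar> \<le> 1 \<Longrightarrow> \<bar>f t\<bar> \<le> M" "\<And>t. \<bar>t\<bar> \<le> 1 \<Longrightarrow> \<bar>g t\<bar> \<le> M'" for f g M M'
    using bound[OF that(2,1,4,3)] by (simp add: mult.commute)
  show "\<psi> g f = 0" if "cont f" "cont g" "\<And>t. f t * g t = 0" for f g
    using disjoint[OF that(2,1)] that(3) by (simp add: mult.commute)
qed (simp_all add: add_left add_right scale_left scale_right)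

lemma sum_left:
  assumes "finite I" "\<And>i. i \<in> I \<Longrightarrow> cont (f i)" "cont g"
  shows "\<psi> (\<lambda>s. \<Sum>i\<in>I. f i s) g = (\<Sum>i\<in>I. \<psi> (f i) g)"
  using assms
proof (induction I rule: finite_induct)
  case empty
  then show ?case by (simp add: disjoint)
next
  case (insert i I)
  then show ?case by (simp add: add_left continuous_on_sum)
qed

lemma sum_right:
  assumes "finite I" "\<And>i. i \<in> I \<Longrightarrow> cont (g i)" "cont f"
  shows "\<psi> f (\<lambda>s. \<Sum>i\<in>I. g i s) = (\<Sum>i\<in>I. \<psi> f (g i))"
  by (rule disjointness_preserving_form.sum_left[OF swap assms])

lemma cont_cut: "cont f \<Longrightarrow> f t = 0 \<Longrightarrow> cont (\<lambda>s. if s \<le> t then 0 else f s)"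
  by (rule continuous_on_cases_le) (auto intro: continuous_on_subset)

text \<open>The function \<open>g\<close> splits at its zero \<open>t\<close> into two continuous pieces, and the left piece is
disjoint from the cut of \<open>f\<close>.\<close>

lemma cut_left:
  assumes "cont f" "f t = 0" "cont g" "g t = 0"
  shows "\<psi> (\<lambda>s. if s \<le> t then 0 else f s) g
    = \<psi> (\<lambda>s. if s \<le> t then 0 else f s) (\<lambda>s. if s \<le> t then 0 else g s)"
proof -
  let ?f = "\<lambda>s. if s \<le> t then 0 else f s" and ?g = "\<lambda>s. if s \<le> t then 0 else g s"
  have c: "cont ?f" "cont ?g" using assms by (auto intro: cont_cut)
  have c': "cont (\<lambda>s. g s - ?g s)" using assms(3) c(2) by (rule continuous_on_diff)
  have "\<psi> ?f g = \<psi> ?f (\<lambda>s. ?g s + (g s - ?g s))" by simp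
  also have "\<dots> = \<psi> ?f ?g + \<psi> ?f (\<lambda>s. g s - ?g s)" by (rule add_right[OF c c'])
  also have "\<psi> ?f (\<lambda>s. g s - ?g s) = 0" by (rule disjoint[OF c(1) c']) simp
  finally show ?thesis by simp
qed

text \<open>The right hand side of the preceding lemma is symmetric in the two arguments.\<close>

lemma cut_swap:
  assumes "cont f" "f t = 0" "cont g" "g t = 0"
  shows "\<psi> (\<lambda>s. if s \<le> t then 0 else f s) g = \<psi> f (\<lambda>s. if s \<le> t then 0 else g s)"
  using cut_left[OF assms] disjointness_preserving_form.cut_left[OF swap assms(3,4,1,2)] by simp

text \<open>If \<open>f\<close> and \<open>g\<close> vanish on a grid of step \<open>1 / N\<close>, then multiplication by the step function \<open>H\<close>
of that grid passes from one argument to the other by the previous lemma. The identity differs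
from \<open>H / N - 2\<close> by at most \<open>2 / N\<close> in the supremum norm, so it passes up to an error of order
\<open>1 / N\<close>. Estimating the \<open>4 N\<close> pieces of \<open>f\<close> and \<open>g\<close> between grid points one by one would lose
this factor.\<close>

lemma id_defect_le:
  fixes N :: nat and \<theta> :: real
  assumes f: "cont f" "\<And>t. \<bar>t\<bar> \<le> 1 \<Longrightarrow> \<bar>f t\<bar> \<le> 1"
    and g: "cont g" "\<And>t. \<bar>t\<bar> \<le> 1 \<Longrightarrow> \<bar>g t\<bar> \<le> 1"
    and N: "0 < N" and \<theta>: "\<bar>\<theta>\<bar> \<le> 1"
    and f0: "\<And>k::int. f ((of_int k + \<theta>) / real N) = 0" and g0: "\<And>k::int. g ((of_int k + \<theta>) / real N) = 0"
  shows "norm (\<psi> (\<lambda>s. s * f s) g - \<psi> f (\<lambda>s. s * g s)) \<le> 4 * K / real N"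
proof -
  let ?I = "{-2 * int N..<2 * int N}"
  define t where "t k = (of_int k + \<theta>) / real N" for k :: int
  define cut where "cut k h s = (if s \<le> t k then 0 else h s)" for k and h :: "real \<Rightarrow> real" and s
  define H where "H h s = (\<Sum>k\<in>?I. cut k h s)" for h s
  define E where "E h s = s * h s + (2 * h s + (- 1 / real N) * H h s)" for h s
  have cH: "cont (H h)" if "cont h" "\<And>k. h (t k) = 0" for h
    unfolding H_def cut_def using that by (intro continuous_on_sum cont_cut)
  have cmul: "cont (\<lambda>s. c * h s)" "cont (\<lambda>s. s * h s)" if "cont h" for c h
    using that by (intro continuous_on_mult continuous_on_const continuous_on_id; simp)+
  have cE: "cont (E h)" if "cont h" "\<And>k. h (t k) = 0" for h
    unfolding E_def using that by (intro continuous_on_add cmul cH)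
  have bE: "\<bar>E h s\<bar> \<le> 2 / real N" if "\<bar>s\<bar> \<le> 1" "\<bar>h s\<bar> \<le> 1" for h s
  proof -
    have "H h s = (\<Sum>k\<in>?I. if s \<le> (of_int k + \<theta>) / real N then 0 else 1) * h s"
      unfolding H_def cut_def t_def sum_distrib_right by (intro sum.cong) auto
    then have "E h s = (s + 2 - (\<Sum>k\<in>?I. if s \<le> (of_int k + \<theta>) / real N then 0 else 1) / real N) * h s"
      unfolding E_def by (simp add: algebra_simps)
    also have "\<bar>\<dots>\<bar> \<le> 2 / real N * 1"
      unfolding abs_mult using grid_count[OF N \<theta> that(1)] that(2) by (intro mult_mono) auto
    finally show ?thesis by simp
  qed
  have t0: "f (t k) = 0" "g (t k) = 0" for k using f0 g0 by (auto simp: t_def)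
  have "\<psi> (H f) g = (\<Sum>k\<in>?I. \<psi> (cut k f) g)"
    unfolding H_def by (rule sum_left) (auto simp: cut_def intro!: cont_cut f g t0)
  also have "\<dots> = (\<Sum>k\<in>?I. \<psi> f (cut k g))"
    unfolding cut_def by (intro sum.cong cut_swap f g t0 refl)
  also have "\<dots> = \<psi> f (H g)"
    unfolding H_def by (rule sum_right[symmetric]) (auto simp: cut_def intro!: cont_cut f g t0)
  finally have H: "\<psi> (H f) g = \<psi> f (H g)" .
  have "\<psi> (E f) g = \<psi> (\<lambda>s. s * f s) g + (2 *\<^sub>R \<psi> f g + (- 1 / real N) *\<^sub>R \<psi> (H f) g)"
    unfolding E_def
    by (subst add_left scale_left, (intro continuous_on_add cmul cH f g t0)+)+ simp
  moreover have "\<psi> f (E g) = \<psi> f (\<lambda>s. s * g s) + (2 *\<^sub>R \<psi> f g + (- 1 / real N) *\<^sub>R \<psi> f (H g))"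
    unfolding E_def
    by (subst add_right scale_right, (intro continuous_on_add cmul cH f g t0)+)+ simp
  ultimately have "\<psi> (\<lambda>s. s * f s) g - \<psi> f (\<lambda>s. s * g s) = \<psi> (E f) g - \<psi> f (E g)"
    by (simp add: H)
  moreover have "norm (\<psi> (E f) g) \<le> K * (2 / real N * 1)"
    using bE f g by (intro bound cE t0) auto
  moreover have "norm (\<psi> f (E g)) \<le> K * (1 * (2 / real N))"
    using bE f g by (intro bound cE t0) auto
  ultimately show ?thesis
    using norm_triangle_ineq4[of "\<psi> (E f) g" "\<psi> f (E g)"] by simp
qed

text \<open>Inserting the partition of unity into both arguments leaves \<open>9\<close> defects, whatever \<open>N\<close> is,
and each of them is of order \<open>1 / N\<close>.\<close>

theorem id_balanced: "\<psi> (\<lambda>s. s) (\<lambda>_. 1) = \<psi> (\<lambda>_. 1) (\<lambda>s. s)"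
proof -
  let ?J = "{-1, 0, 1 :: int}"
  have le: "norm (\<psi> (\<lambda>s. s) (\<lambda>_. 1) - \<psi> (\<lambda>_. 1) (\<lambda>s. s)) \<le> 36 * K / real N" if N: "0 < N" for N
  proof -
    let ?\<chi> = "third_root_bump N"
    have c: "cont (?\<chi> i)" "cont (\<lambda>s. s * ?\<chi> i s)" for i
      by (intro continuous_third_root_bump continuous_on_mult continuous_on_id)+
    have one: "(\<lambda>_. 1) = (\<lambda>s. \<Sum>i\<in>?J. ?\<chi> i s)"
      by (simp only: third_root_bump_sum)
    have "(\<lambda>s. s) = (\<lambda>s. s * (\<Sum>i\<in>?J. ?\<chi> i s))"
      by (simp only: third_root_bump_sum mult_1_right)
    also have "\<dots> = (\<lambda>s. \<Sum>i\<in>?J. s * ?\<chi> i s)" by (simp only: sum_distrib_left)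
    finally have id: "(\<lambda>s. s) = (\<lambda>s. \<Sum>i\<in>?J. s * ?\<chi> i s)" .
    have expand: "\<psi> (\<lambda>s. \<Sum>i\<in>?J. f i s) (\<lambda>s. \<Sum>j\<in>?J. g j s) = (\<Sum>i\<in>?J. \<Sum>j\<in>?J. \<psi> (f i) (g j))"
      if "\<And>i. cont (f i)" "\<And>j. cont (g j)" for f g
    proof -
      have "\<psi> (\<lambda>s. \<Sum>i\<in>?J. f i s) (\<lambda>s. \<Sum>j\<in>?J. g j s) = (\<Sum>i\<in>?J. \<psi> (f i) (\<lambda>s. \<Sum>j\<in>?J. g j s))"
        by (intro sum_left continuous_on_sum that) simp
      also have "\<dots> = (\<Sum>i\<in>?J. \<Sum>j\<in>?J. \<psi> (f i) (g j))"
        by (intro sum.cong refl sum_right that) simp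
      finally show ?thesis .
    qed
    have left: "\<psi> (\<lambda>s. s) (\<lambda>_. 1) = (\<Sum>i\<in>?J. \<Sum>j\<in>?J. \<psi> (\<lambda>s. s * ?\<chi> i s) (?\<chi> j))"
      by (rule trans[OF arg_cong2[where f = \<psi>, OF id one] expand[OF c(2,1)]])
    have right: "\<psi> (\<lambda>_. 1) (\<lambda>s. s) = (\<Sum>i\<in>?J. \<Sum>j\<in>?J. \<psi> (?\<chi> i) (\<lambda>s. s * ?\<chi> j s))"
      by (rule trans[OF arg_cong2[where f = \<psi>, OF one id] expand[OF c]])
    have "\<psi> (\<lambda>s. s) (\<lambda>_. 1) - \<psi> (\<lambda>_. 1) (\<lambda>s. s)
        = (\<Sum>i\<in>?J. \<Sum>j\<in>?J. \<psi> (\<lambda>s. s * ?\<chi> i s) (?\<chi> j) - \<psi> (?\<chi> i) (\<lambda>s. s * ?\<chi> j s))"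
      unfolding left right by (simp only: sum_subtractf)
    also have "norm \<dots> \<le> (\<Sum>i\<in>?J. \<Sum>j\<in>?J. 4 * K / real N)"
    proof (rule sum_norm_le, rule sum_norm_le)
      fix i j assume ij: "i \<in> ?J" "j \<in> ?J"
      obtain l where l: "l \<in> ?J" "l \<noteq> i" "l \<noteq> j"
      proof -
        have "(-1 \<noteq> i \<and> -1 \<noteq> j) \<or> (0 \<noteq> i \<and> 0 \<noteq> j) \<or> (1 \<noteq> i \<and> 1 \<noteq> j)" by linarith
        then show ?thesis using that by blast
      qed
      show "norm (\<psi> (\<lambda>s. s * ?\<chi> i s) (?\<chi> j) - \<psi> (?\<chi> i) (\<lambda>s. s * ?\<chi> j s)) \<le> 4 * K / real N"
      proof (rule id_defect_le[where \<theta> = "of_int l / 3"])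
        show "\<bar>of_int l / 3\<bar> \<le> (1::real)" using l(1) by auto
        show "?\<chi> i ((of_int k + of_int l / 3) / real N) = 0" for k
          using third_root_bump_zero ij l N by metis
        show "?\<chi> j ((of_int k + of_int l / 3) / real N) = 0" for k
          using third_root_bump_zero ij l N by metis
      qed (rule c(1) third_root_bump_bound N)+
    qed
    also have "\<dots> = 36 * K / real N" by simp
    finally show ?thesis .
  qed
  have "(\<lambda>n. (36 * K) * inverse (real (Suc n))) \<longlonglongrightarrow> (36 * K) * 0"
    by (intro tendsto_mult tendsto_const LIMSEQ_inverse_real_of_nat)
  then have "norm (\<psi> (\<lambda>s. s) (\<lambda>_. 1) - \<psi> (\<lambda>_. 1) (\<lambda>s. s)) \<le> (36 * K) * 0"
  proof (rule LIMSEQ_le_const)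
    show "\<exists>m. \<forall>n\<ge>m. norm (\<psi> (\<lambda>s. s) (\<lambda>_. 1) - \<psi> (\<lambda>_. 1) (\<lambda>s. s))
        \<le> 36 * K * inverse (real (Suc n))"
      using le[OF zero_less_Suc] unfolding divide_inverse by blast
  qed
  then show ?thesis by simp
qed

end

text \<open>C*-algebras are zero product determined. For a self-adjoint contraction \<open>x\<close> with functional
calculus \<open>F\<close>, the form \<open>\<psi> f g = \<phi> (a F f) (F g c)\<close> vanishes on pairs with disjoint supports,
and the claim is that \<open>\<psi>\<close> balances the identity function. Scaling and the decomposition into
self-adjoint parts give the general case; the last hypothesis is what remains of complex
bilinearity of \<open>\<phi>\<close>.\<close>

theorem zero_product_balanced:
  fixes \<phi> :: "'a::unital_cstar_algebra \<Rightarrow> 'a \<Rightarrow> 'b::real_normed_vector"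
  assumes \<phi>: "bounded_bilinear \<phi>"
    and zero: "\<And>a c. a * c = 0 \<Longrightarrow> \<phi> a c = 0"
    and imaginary: "\<And>a c. \<phi> (\<i> *\<^sub>C a) c = \<phi> a (\<i> *\<^sub>C c)"
  shows "\<phi> (a * x) c = \<phi> a (x * c)"
proof -
  interpret \<phi>: bounded_bilinear \<phi> by (rule \<phi>)
  obtain K where K: "0 \<le> K" "\<And>a c. norm (\<phi> a c) \<le> norm a * norm c * K"
    using \<phi>.nonneg_bounded by blast
  have contraction: "\<phi> (a * b) c = \<phi> a (b * c)" if b: "b\<^sup>\<star> = b" "norm b < 1" for a b c
  proof -
    obtain F where F: "\<And>p f e. continuous_on {-1..1} f \<Longrightarrow> (\<And>t. \<bar>t\<bar> \<le> 1 \<Longrightarrow> \<bar>f t - poly p t\<bar> \<le> e) \<Longrightarrow>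
        norm (F f - poly_at p b) \<le> e"
      using functional_calculus[OF b] by blast
    interpret continuous_functional_calculus b F
      by unfold_locales (fact F)
    define \<psi> where "\<psi> f g = \<phi> (a * F f) (F g * c)" for f g
    interpret disjointness_preserving_form \<psi> "norm a * norm c * K"
    proof
      fix f g :: "real \<Rightarrow> real" and M M' :: real
      assume fg: "cont f" "cont g" and M: "\<And>t. \<bar>t\<bar> \<le> 1 \<Longrightarrow> \<bar>f t\<bar> \<le> M" "\<And>t. \<bar>t\<bar> \<le> 1 \<Longrightarrow> \<bar>g t\<bar> \<le> M'"
      have "0 \<le> M" "0 \<le> M'" using M(1)[of 0] M(2)[of 0] by auto
      have "norm (a * F f) \<le> norm a * M"
        using norm_mult_ineq[of a "F f"] norm_F_le[OF fg(1) M(1)]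
        by (meson mult_left_mono norm_ge_zero order.trans)
      moreover have "norm (F g * c) \<le> M' * norm c"
        using norm_mult_ineq[of "F g" c] norm_F_le[OF fg(2) M(2)]
        by (meson mult_right_mono norm_ge_zero order.trans)
      ultimately have "norm (a * F f) * norm (F g * c) * K \<le> (norm a * M) * (M' * norm c) * K"
        using \<open>0 \<le> M\<close> \<open>0 \<le> M'\<close> K(1) by (intro mult_mono mult_nonneg_nonneg) auto
      then show "norm (\<psi> f g) \<le> norm a * norm c * K * (M * M')"
        unfolding \<psi>_def using K(2)[of "a * F f" "F g * c"] by (simp add: mult_ac)
    next
      fix f g :: "real \<Rightarrow> real"
      assume fg: "cont f" "cont g" and "\<And>t. f t * g t = 0"
      then have "(\<lambda>t. f t * g t) = (\<lambda>_. 0)" by (intro ext)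
      then have "F f * F g = 0" using F_mult[OF fg] F_zero by (simp only:)
      then have "(a * F f) * (F g * c) = 0" by (metis mult.assoc mult_zero_left mult_zero_right)
      then show "\<psi> f g = 0" unfolding \<psi>_def by (rule zero)
    qed (simp_all add: \<psi>_def F_add F_scale \<phi>.add_left \<phi>.add_right \<phi>.scaleR_left \<phi>.scaleR_right
        distrib_left distrib_right)
    show ?thesis using id_balanced by (simp add: \<psi>_def F_id F_one)
  qed
  have selfadjoint: "\<phi> (a * b) c = \<phi> a (b * c)" if b: "b\<^sup>\<star> = b" for a b c
  proof -
    obtain r where r: "r \<noteq> 0" "norm (r *\<^sub>R b) < 1" using contraction_scaling .
    have "\<phi> (a * (r *\<^sub>R b)) c = \<phi> a ((r *\<^sub>R b) * c)"
      by (rule contraction) (simp_all only: star_scaleR b r)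
    then show ?thesis using r(1) by (simp add: \<phi>.scaleR_left \<phi>.scaleR_right)
  qed
  obtain y z where yz: "y\<^sup>\<star> = y" "z\<^sup>\<star> = z" "x = y + \<i> *\<^sub>C z"
    using cartesian_decomposition .
  show ?thesis
    unfolding yz(3) using selfadjoint[OF yz(1)] selfadjoint[OF yz(2)] imaginary
    by (simp add: distrib_left distrib_right \<phi>.add_left \<phi>.add_right mult_scaleC_left mult_scaleC_right)
qed

section \<open>Pairs of maps determined by zero products\<close>

lemma centre_commute: "z \<in> centre \<Longrightarrow> z * x = x * z"
  by (simp add: centre_def)

lemma centre_minus: "z \<in> centre \<Longrightarrow> - z \<in> centre"
  by (simp add: centre_def)

text \<open>Replacing \<open>a\<close> by \<open>x a\<close> shows that \<open>y A [A, A] = 0\<close>. As \<open>[y, a] x\<close> lies in \<open>y A + A y A\<close>,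
this gives \<open>[y, a] A [y, a] = 0\<close>.\<close>

lemma centre_if_annihilates_commutators:
  fixes y :: "'a::unital_cstar_algebra"
  assumes "\<And>a b. y * \<lbrakk>a, b\<rbrakk>\<^sub>c = 0"
  shows "y \<in> centre"
proof -
  have mid: "y * x * \<lbrakk>a, b\<rbrakk>\<^sub>c = 0" for x a b
  proof -
    have "y * x * \<lbrakk>a, b\<rbrakk>\<^sub>c = y * \<lbrakk>x * a, b\<rbrakk>\<^sub>c - y * \<lbrakk>x, b\<rbrakk>\<^sub>c * a"
      by (simp add: commutator_def algebra_simps)
    then show ?thesis by (simp add: assms)
  qed
  have "\<lbrakk>y, a\<rbrakk>\<^sub>c = 0" for a
  proof (rule cstar_semiprime)
    fix x
    have "\<lbrakk>y, a\<rbrakk>\<^sub>c * x * \<lbrakk>y, a\<rbrakk>\<^sub>c = y * (a * x) * \<lbrakk>y, a\<rbrakk>\<^sub>c - a * (y * x * \<lbrakk>y, a\<rbrakk>\<^sub>c)"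
      by (simp add: commutator_def[of y a] algebra_simps)
    then show "\<lbrakk>y, a\<rbrakk>\<^sub>c * x * \<lbrakk>y, a\<rbrakk>\<^sub>c = 0" by (simp add: mid)
  qed
  then show ?thesis by (simp add: centre_def commutator_def)
qed

text \<open>Successive linearisations: \<open>c \<mapsto> x c\<close> inserts an arbitrary factor, polarisation in \<open>a\<close>
makes the product antisymmetric in \<open>a\<close> and \<open>b\<close>, and semiprimeness turns the antisymmetry into
\<open>[x, a] A D b = 0\<close> for all \<open>x\<close>, \<open>a\<close>, \<open>b\<close>. Choosing \<open>x = D b\<close> ends the proof.\<close>

lemma central_valued_if_annihilated_by_own_commutators:
  fixes D :: "'a::unital_cstar_algebra \<Rightarrow> 'a"
  assumes add: "\<And>a b. D (a + b) = D a + D b"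
    and own: "\<And>a c. \<lbrakk>c, a\<rbrakk>\<^sub>c * D a = 0"
  shows "D b \<in> centre"
proof -
  have self: "\<lbrakk>x, a\<rbrakk>\<^sub>c * c * D a = 0" for x a c
  proof -
    have "\<lbrakk>x, a\<rbrakk>\<^sub>c * c * D a = \<lbrakk>x * c, a\<rbrakk>\<^sub>c * D a - x * (\<lbrakk>c, a\<rbrakk>\<^sub>c * D a)"
      by (simp add: commutator_def algebra_simps)
    then show ?thesis by (simp add: own)
  qed
  have flip: "D a * r * \<lbrakk>x, a\<rbrakk>\<^sub>c = 0" for a r x
  proof (rule cstar_semiprime)
    fix s
    have "D a * r * \<lbrakk>x, a\<rbrakk>\<^sub>c * s * (D a * r * \<lbrakk>x, a\<rbrakk>\<^sub>c)
        = D a * r * (\<lbrakk>x, a\<rbrakk>\<^sub>c * s * D a) * r * \<lbrakk>x, a\<rbrakk>\<^sub>c"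
      by (simp add: mult.assoc)
    then show "D a * r * \<lbrakk>x, a\<rbrakk>\<^sub>c * s * (D a * r * \<lbrakk>x, a\<rbrakk>\<^sub>c) = 0" by (simp add: self)
  qed
  have anti: "\<lbrakk>x, a\<rbrakk>\<^sub>c * c * D b = - (\<lbrakk>x, b\<rbrakk>\<^sub>c * c * D a)" for x a b c
  proof -
    have "\<lbrakk>x, a + b\<rbrakk>\<^sub>c * c * D (a + b)
        = \<lbrakk>x, a\<rbrakk>\<^sub>c * c * D a + \<lbrakk>x, b\<rbrakk>\<^sub>c * c * D b + (\<lbrakk>x, a\<rbrakk>\<^sub>c * c * D b + \<lbrakk>x, b\<rbrakk>\<^sub>c * c * D a)"
      by (simp add: add commutator_def algebra_simps)
    then show ?thesis by (simp add: self eq_neg_iff_add_eq_0)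
  qed
  have all: "\<lbrakk>x, a\<rbrakk>\<^sub>c * c * D b = 0" for x a c
  proof (rule cstar_semiprime)
    fix r
    have "\<lbrakk>x, a\<rbrakk>\<^sub>c * c * D b * r * w = - (\<lbrakk>x, b\<rbrakk>\<^sub>c * c * (D a * r * w))" for w
      by (simp only: anti[of x a c b]) (simp add: mult.assoc)
    moreover have "D a * r * (\<lbrakk>x, a\<rbrakk>\<^sub>c * c * D b) = 0"
      using flip[of a r x] by (simp flip: mult.assoc)
    ultimately show "\<lbrakk>x, a\<rbrakk>\<^sub>c * c * D b * r * (\<lbrakk>x, a\<rbrakk>\<^sub>c * c * D b) = 0" by simp
  qed
  have "\<lbrakk>D b, a\<rbrakk>\<^sub>c = 0" for a
  proof (rule cstar_semiprime)
    fix x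
    have "\<lbrakk>D b, a\<rbrakk>\<^sub>c * x * \<lbrakk>D b, a\<rbrakk>\<^sub>c
        = \<lbrakk>D b, a\<rbrakk>\<^sub>c * x * D b * a - \<lbrakk>D b, a\<rbrakk>\<^sub>c * (x * a) * D b"
      by (subst (2) commutator_def) (simp add: right_diff_distrib mult.assoc)
    then show "\<lbrakk>D b, a\<rbrakk>\<^sub>c * x * \<lbrakk>D b, a\<rbrakk>\<^sub>c = 0" by (simp add: all)
  qed
  then show ?thesis by (simp add: centre_def commutator_def)
qed

text \<open>For a unitary \<open>u\<close> the Leibniz rule gives \<open>D (u ^ n) = n u\<^bsup>n-1\<^esup> D u\<close>, whose norm is
\<open>n norm (D u)\<close>, while boundedness keeps it below a constant. So \<open>D\<close> vanishes on unitaries, and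
these span the algebra. Commuting factors are those for which the defect
\<open>S a - S 1 a\<close> of the structure theorem obeys the Leibniz rule at once.\<close>

lemma central_valued_derivation_zero:
  fixes D :: "'a::unital_cstar_algebra \<Rightarrow> 'a"
  assumes lin: "clinear D" and D: "bounded_linear D"
    and central: "\<And>a. D a \<in> centre"
    and leibniz: "\<And>a b. a * b = b * a \<Longrightarrow> D (a * b) = D a * b + a * D b"
  shows "D a = 0"
proof -
  interpret D: bounded_linear D by (rule D)
  obtain K where K: "\<And>x. norm (D x) \<le> norm x * K"
    using D.bounded by blast
  have comm: "D x * y = y * D x" for x y using central[of x] by (simp add: centre_def)
  have unitary: "D u = 0" if u: "u\<^sup>\<star> * u = 1" for u
  proof -
    have Dpow: "D (u ^ Suc n) = of_nat (Suc n) *\<^sub>R (u ^ n * D u)" for n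
    proof (induction n)
      case (Suc n)
      have "D (u ^ Suc (Suc n)) = D u * u ^ Suc n + u * D (u ^ Suc n)"
        using leibniz[of u "u ^ Suc n"] by (simp add: power_commutes mult.assoc)
      also have "\<dots> = u ^ Suc n * D u + of_nat (Suc n) *\<^sub>R (u ^ Suc n * D u)"
        unfolding Suc comm[of u] by (simp add: mult.assoc)
      finally show ?case by (simp add: scaleR_add_left scaleR_2)
    qed simp
    have growth: "real (Suc n) * norm (D u) \<le> \<bar>K\<bar>" for n
    proof -
      have "D u = (u\<^sup>\<star>) ^ n * (u ^ n * D u)" using unitary_power[OF u, of n] by (metis mult.assoc mult_1)
      then have "norm (D u) \<le> norm ((u\<^sup>\<star>) ^ n) * norm (u ^ n * D u)"
        using norm_mult_ineq by metis
      also have "\<dots> \<le> 1 * norm (u ^ n * D u)"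
        using norm_power_le[of "u\<^sup>\<star>" n] norm_unitary_le[OF u] by (intro mult_right_mono) auto
      finally have "real (Suc n) * norm (D u) \<le> real (Suc n) * norm (u ^ n * D u)" by simp
      also have "\<dots> = norm (D (u ^ Suc n))" unfolding Dpow by simp
      also have "\<dots> \<le> norm (u ^ Suc n) * \<bar>K\<bar>"
        using K[of "u ^ Suc n"] by (meson abs_ge_self mult_left_mono norm_ge_zero order.trans)
      also have "\<dots> \<le> 1 * \<bar>K\<bar>"
        by (intro mult_right_mono norm_power_le norm_unitary_le u) simp
      finally show ?thesis by simp
    qed
    show ?thesis
    proof (rule ccontr)
      assume "D u \<noteq> 0"
      then obtain n where "\<bar>K\<bar> < real n * norm (D u)"
        using reals_Archimedean3[of "norm (D u)"] by auto
      also have "real n * norm (D u) \<le> real (Suc n) * norm (D u)"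
        by (intro mult_right_mono) simp_all
      finally show False using growth[of n] by simp
    qed
  qed
  have contraction: "D b = 0" if b: "b\<^sup>\<star> = b" "norm b < 1" for b
  proof -
    obtain u where u: "u\<^sup>\<star> * u = 1" "u * u\<^sup>\<star> = 1" "b = (1/2) *\<^sub>R (u + u\<^sup>\<star>)"
      using selfadjoint_contraction_real_part_of_unitary[OF b] .
    have "D u = 0" "D (u\<^sup>\<star>) = 0" using u by (auto intro!: unitary simp: star_star)
    then show ?thesis by (simp add: u(3) D.scaleR D.add)
  qed
  have selfadjoint: "D b = 0" if b: "b\<^sup>\<star> = b" for b
  proof -
    obtain r where r: "r \<noteq> 0" "norm (r *\<^sub>R b) < 1" using contraction_scaling .
    have "D (r *\<^sub>R b) = 0" by (rule contraction) (simp_all only: star_scaleR b r)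
    then show ?thesis using r(1) by (simp add: D.scaleR)
  qed
  obtain x y where xy: "x\<^sup>\<star> = x" "y\<^sup>\<star> = y" "a = x + \<i> *\<^sub>C y"
    using cartesian_decomposition .
  have "\<i> *\<^sub>C (0::'a) = 0" using norm_scaleC[of \<i> "0::'a"] by simp
  then show ?thesis
    using lin selfadjoint[OF xy(1)] selfadjoint[OF xy(2)] by (simp add: xy(3) clinear_def)
qed

text \<open>Put \<open>\<omega> = S 1\<close> and \<open>\<sigma> = T 1\<close>. Balancing the bilinear map and setting one argument to
\<open>1\<close> expresses \<open>S (a b)\<close>, \<open>T (b c)\<close> and \<open>T - S\<close> through \<open>S\<close>, \<open>T\<close>, \<open>\<omega>\<close>, \<open>\<sigma>\<close>. Substituted back into the
balanced identity, they give \<open>E c [a, b] + [c, b] D a = 0\<close> for the defects \<open>D a = S a - \<omega> a\<close> and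
\<open>E c = T c - c \<sigma>\<close>. The case \<open>b = a\<close> makes \<open>D\<close> central valued; on commuting elements \<open>D\<close> satisfies
the Leibniz rule, hence \<open>D = 0\<close>. The product rule for \<open>S\<close> then says that \<open>\<omega> + \<sigma>\<close> annihilates
commutators, so that it is central, and this forces \<open>E = 0\<close>.\<close>

theorem zero_product_pair_structure:
  fixes S T :: "'a::unital_cstar_algebra \<Rightarrow> 'a"
  assumes S: "clinear S" "bounded_linear S" and T: "clinear T" "bounded_linear T"
    and zero: "\<And>a c. a * c = 0 \<Longrightarrow> T c * a + c * S a = 0"
  shows "S a = S 1 * a" "T c = c * T 1" "S 1 + T 1 \<in> centre" "(S 1 + T 1) * \<lbrakk>a, c\<rbrakk>\<^sub>c = 0"
proof -
  interpret S: bounded_linear S by (rule S)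
  interpret T: bounded_linear T by (rule T)
  define \<omega> \<sigma> where "\<omega> = S 1" and "\<sigma> = T 1"
  obtain KS KT where K: "\<And>a. norm (S a) \<le> norm a * KS" "\<And>c. norm (T c) \<le> norm c * KT"
    using S.bounded T.bounded by blast
  have "bounded_bilinear (\<lambda>a c. T c * a + c * S a)"
  proof (rule bounded_bilinear.intro)
    show "\<exists>K. \<forall>a c. norm (T c * a + c * S a) \<le> norm a * norm c * K"
    proof (intro exI allI)
      fix a c
      have "norm (T c * a + c * S a) \<le> norm (T c) * norm a + norm c * norm (S a)"
        by (intro norm_triangle_mono norm_mult_ineq)
      also have "\<dots> \<le> (norm c * KT) * norm a + norm c * (norm a * KS)"
        by (intro add_mono mult_left_mono mult_right_mono K norm_ge_zero)
      finally show "norm (T c * a + c * S a) \<le> norm a * norm c * (KT + KS)"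
        by (simp add: algebra_simps)
    qed
  qed (simp_all add: S.add T.add S.scaleR T.scaleR algebra_simps)
  then have balanced: "T c * (a * b) + c * S (a * b) = T (b * c) * a + (b * c) * S a" for a b c
    by (rule zero_product_balanced)
      (use S(1) T(1) in \<open>auto simp: zero clinear_def mult_scaleC_left mult_scaleC_right\<close>)
  define D where "D a = S a - \<omega> * a" for a
  define E where "E c = T c - c * \<sigma>" for c
  have S_prod: "S (a * b) = T b * a + b * S a - \<sigma> * (a * b)" for a b
    using balanced[of 1 a b] by (simp add: \<sigma>_def algebra_simps)
  have T_prod: "T (b * c) = T c * b + c * S b - b * c * \<omega>" for b c
    using balanced[of c 1 b] by (simp add: \<omega>_def algebra_simps)
  have T_S: "T b = \<sigma> * b + S b - b * \<omega>" for b
    using S_prod[of 1 b] by (simp add: \<omega>_def algebra_simps)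
  have key: "E c * \<lbrakk>a, b\<rbrakk>\<^sub>c + \<lbrakk>c, b\<rbrakk>\<^sub>c * D a = 0" for a b c
  proof -
    have "T c * (a * b) + c * (T b * a + b * S a - \<sigma> * (a * b))
        = (T c * b + c * S b - b * c * \<omega>) * a + b * c * S a"
      using balanced[of c a b] by (simp only: S_prod T_prod)
    then show ?thesis
      unfolding E_def D_def commutator_def T_S[of b] by (simp add: algebra_simps)
  qed
  have "\<lbrakk>c, a\<rbrakk>\<^sub>c * D a = 0" for a c
    using key[of c a a] by (simp add: commutator_def)
  then have D_central: "D a \<in> centre" for a
    by (intro central_valued_if_annihilated_by_own_commutators[of D])
      (auto simp: D_def S.add algebra_simps)
  have "D a = 0" for a
  proof (rule central_valued_derivation_zero[OF _ _ D_central])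
    show "clinear D"
    proof -
      have "c *\<^sub>C (x - y) = c *\<^sub>C x - c *\<^sub>C y" for c and x y :: 'a
        using scaleC_add_right[of c "x - y" y] by (simp add: algebra_simps)
      then show ?thesis
        using S(1) by (simp add: clinear_def D_def algebra_simps mult_scaleC_right)
    qed
    show "bounded_linear D" unfolding D_def
      by (intro bounded_linear_sub S(2) bounded_linear_mult_right)
    show "D (a * b) = D a * b + a * D b" if ab: "a * b = b * a" for a b
    proof -
      have "D (a * b) = D b * a + b * D a"
      proof -
        have "D (a * b) = T b * a + b * S a - \<sigma> * (b * a) - \<omega> * (b * a)"
          using S_prod[of a b] by (simp add: D_def ab)
        also have "\<dots> = D b * a + b * D a"
          by (simp add: D_def T_S[of b] algebra_simps)
        finally show ?thesis .
      qed
      then show ?thesis using centre_commute[OF D_central, of a b] centre_commute[OF D_central, of b a]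
        by (simp add: add.commute)
    qed
  qed
  then have S_eq: "S a = \<omega> * a" for a by (simp add: D_def)
  show ann: "(S 1 + T 1) * \<lbrakk>a, c\<rbrakk>\<^sub>c = 0" for a c
    using S_prod[of a c] unfolding T_S[of c] S_eq \<omega>_def[symmetric] \<sigma>_def[symmetric] commutator_def
    by (simp add: algebra_simps)
  show central: "S 1 + T 1 \<in> centre"
    by (rule centre_if_annihilates_commutators) (rule ann)
  show "S a = S 1 * a" unfolding \<omega>_def[symmetric] by (rule S_eq)
  have "(\<omega> + \<sigma>) * c = c * (\<omega> + \<sigma>)" unfolding \<omega>_def \<sigma>_def by (rule centre_commute[OF central])
  then show "T c = c * T 1"
    unfolding T_S[of c] S_eq \<sigma>_def[symmetric] by (simp add: algebra_simps)
qed

section \<open>Characterisation of the maps\<close>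

lemma bounded_linear_of_continuous_clinear:
  fixes f :: "'a::complex_normed_vector \<Rightarrow> 'b::complex_normed_vector"
  assumes lin: "clinear f" and cont: "continuous_on UNIV f"
  shows "bounded_linear f"
proof -
  have add: "f (x + y) = f x + f y" and scaleR: "f (r *\<^sub>R x) = r *\<^sub>R f x" for x y r
    using lin by (simp_all add: clinear_def flip: scaleC_of_real)
  have f0: "f 0 = 0" using scaleR[of 0 0] by simp
  have "isCont f 0" using cont by (simp add: continuous_on_eq_continuous_at)
  then obtain d where d: "0 < d" "\<And>x. norm x < d \<Longrightarrow> norm (f x) < 1"
    unfolding continuous_at_eps_delta by (auto simp: f0 dist_norm dest: spec[of _ 1])
  show ?thesis
  proof (rule bounded_linear_intro[OF add scaleR])
    fix x
    show "norm (f x) \<le> norm x * (2 / d)"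
    proof (cases "x = 0")
      case False
      define r where "r = d / (2 * norm x)"
      have r: "0 < r" "r * norm x = d / 2" using d(1) False by (simp_all add: r_def)
      then have "norm (r *\<^sub>R x) < d" using d(1) by simp
      then have "r * norm (f x) < 1" using d(2)[of "r *\<^sub>R x"] r(1) by (simp add: scaleR)
      then have "norm (f x) \<le> 1 / r" using r(1) by (simp add: pos_le_divide_eq mult.commute)
      then show ?thesis by (simp add: r_def mult.commute)
    qed (simp add: f0)
  qed
qed

lemma adjoint_map:
  fixes f :: "'a::unital_cstar_algebra \<Rightarrow> 'a"
  assumes "clinear f" "bounded_linear f"
  shows "clinear (\<lambda>a. (f (a\<^sup>\<star>))\<^sup>\<star>)" "bounded_linear (\<lambda>a. (f (a\<^sup>\<star>))\<^sup>\<star>)"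
proof -
  show "clinear (\<lambda>a. (f (a\<^sup>\<star>))\<^sup>\<star>)"
    using assms(1) by (simp add: clinear_def star_add star_scaleC star_star)
  show "bounded_linear (\<lambda>a. (f (a\<^sup>\<star>))\<^sup>\<star>)"
    by (intro bounded_linear_compose[OF bounded_linear_star]
        bounded_linear_compose[OF assms(2)] bounded_linear_star)
qed

lemma re_part_centre_iff:
  "re_part \<mu> \<in> centre \<longleftrightarrow> \<mu> + \<mu>\<^sup>\<star> \<in> centre" for \<mu> :: "'a::unital_cstar_algebra"
  by (simp add: re_part_def centre_def)

text \<open>Each necessity proof applies the structure theorem to \<open>\<delta>\<close> and, in the starred cases, its
adjoint map \<open>\<tau> a = (\<delta> (a\<^sup>\<star>))\<^sup>\<star>\<close>, which turns \<open>a b\<^sup>\<star> = 0\<close> or \<open>a\<^sup>\<star> b = 0\<close> into a plain zero product.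
The witnesses are \<open>(\<delta> 1, 0)\<close>, \<open>(- \<delta> 1, 0)\<close> and \<open>(\<delta> 1, 0)\<close> for \<open>(\<mu>, \<nu>)\<close>. In the sufficiency proofs
\<open>a b = 0\<close> gives \<open>[a, b] = - b a\<close>, and the commutator condition at this pair (in the starred parts at
\<open>a, b\<^sup>\<star>\<close> or \<open>a\<^sup>\<star>, b\<close>) becomes the required identity once the central element is moved between
the two factors.\<close>

theorem proposition2p8:
  fixes \<delta> :: "'a::unital_cstar_algebra \<Rightarrow> 'a"
  assumes A: "(\<exists>\<pi> :: 'a \<Rightarrow> ('h::complex_hilbert_space \<Rightarrow>\<^sub>L 'h). von_neumann_realization \<pi>)
      \<or> simple_cstar_algebra TYPE('a)"
    and linear: "clinear \<delta>"
    and continuous: "continuous_on UNIV \<delta>"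
  shows "((\<forall>a b. a * b = 0 \<longrightarrow> b * \<delta> a + \<delta> b * a = 0) \<longleftrightarrow>
       (\<exists>\<mu> \<nu>. (\<forall>a. \<delta> a = a * \<mu> - \<nu> * a) \<and> \<mu> - \<nu> \<in> centre \<and>
          (\<forall>a b. \<lbrakk>\<lbrakk>a, b\<rbrakk>\<^sub>c, \<mu>\<rbrakk>\<^sub>c + 2 *\<^sub>R (\<lbrakk>a, b\<rbrakk>\<^sub>c * (\<mu> - \<nu>)) = 0)))
    \<and> ((\<forall>a b. a * b\<^sup>\<star> = 0 \<longrightarrow> (\<delta> b)\<^sup>\<star> * a + b\<^sup>\<star> * \<delta> a = 0) \<longleftrightarrow>
       (\<exists>\<mu> \<nu>. (\<forall>a. \<delta> a = a * \<nu> - \<mu> * a) \<and> re_part \<mu> \<in> centre \<and>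
          (\<forall>a b. \<lbrakk>\<lbrakk>a, b\<rbrakk>\<^sub>c, \<mu>\<rbrakk>\<^sub>c + (\<nu> - \<mu>)\<^sup>\<star> * \<lbrakk>a, b\<rbrakk>\<^sub>c + \<lbrakk>a, b\<rbrakk>\<^sub>c * (\<nu> - \<mu>) = 0)))
    \<and> ((\<forall>a b. a\<^sup>\<star> * b = 0 \<longrightarrow> \<delta> b * a\<^sup>\<star> + b * (\<delta> a)\<^sup>\<star> = 0) \<longleftrightarrow>
       (\<exists>\<mu> \<nu>. (\<forall>a. \<delta> a = a * \<mu> - \<nu> * a) \<and> re_part \<mu> \<in> centre \<and>
          (\<forall>a b. \<lbrakk>\<lbrakk>a, b\<rbrakk>\<^sub>c, \<mu>\<rbrakk>\<^sub>c + \<lbrakk>a, b\<rbrakk>\<^sub>c * (\<mu> - \<nu>)\<^sup>\<star> + (\<mu> - \<nu>) * \<lbrakk>a, b\<rbrakk>\<^sub>c = 0)))"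
    (is "(?L1 \<longleftrightarrow> ?R1) \<and> (?L2 \<longleftrightarrow> ?R2) \<and> (?L3 \<longleftrightarrow> ?R3)")
proof -
  have bounded: "bounded_linear \<delta>" using bounded_linear_of_continuous_clinear linear continuous .
  define \<tau> where "\<tau> a = (\<delta> (a\<^sup>\<star>))\<^sup>\<star>" for a
  have \<tau>: "clinear \<tau>" "bounded_linear \<tau>" unfolding \<tau>_def by (rule adjoint_map[OF linear bounded])+
  have \<tau>_one: "\<tau> 1 = (\<delta> 1)\<^sup>\<star>" by (simp add: \<tau>_def)
  have "?R1" if L: "?L1"
  proof -
    have L1: "\<delta> c * a + c * \<delta> a = 0" if "a * c = 0" for a c
      by (rule trans[OF add.commute L[rule_format, OF that]])
    note struct = zero_product_pair_structure[where S = \<delta> and T = \<delta>,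
        OF linear bounded linear bounded L1]
    show ?R1
    proof (intro exI conjI allI)
      show "\<delta> a = a * \<delta> 1 - 0 * a" for a using struct(2)[of a] by simp
      have comm: "\<delta> 1 * a = a * \<delta> 1" for a by (rule trans[OF struct(1)[symmetric] struct(2)])
      then show "\<delta> 1 - 0 \<in> centre" by (simp add: centre_def)
      show "\<lbrakk>\<lbrakk>a, b\<rbrakk>\<^sub>c, \<delta> 1\<rbrakk>\<^sub>c + 2 *\<^sub>R (\<lbrakk>a, b\<rbrakk>\<^sub>c * (\<delta> 1 - 0)) = 0" for a b
        using struct(4)[of a b] unfolding commutator_def[of "\<lbrakk>a, b\<rbrakk>\<^sub>c"]
        by (simp only: comm[of "\<lbrakk>a, b\<rbrakk>\<^sub>c"] scaleR_2 distrib_right diff_0_right diff_self add_0)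
    qed
  qed
  moreover have "?L1" if R: "?R1"
  proof (intro allI impI)
    obtain \<mu> \<nu> where \<delta>: "\<And>a. \<delta> a = a * \<mu> - \<nu> * a" and z: "\<mu> - \<nu> \<in> centre"
      and c: "\<And>a b. \<lbrakk>\<lbrakk>a, b\<rbrakk>\<^sub>c, \<mu>\<rbrakk>\<^sub>c + 2 *\<^sub>R (\<lbrakk>a, b\<rbrakk>\<^sub>c * (\<mu> - \<nu>)) = 0"
      using R by blast
    fix a b :: 'a assume ab: "a * b = 0"
    have c': "\<lbrakk>a, b\<rbrakk>\<^sub>c = - (b * a)" by (simp add: commutator_def ab)
    have zero: "b * a * \<mu> - \<mu> * (b * a) + (b * a * (\<mu> - \<nu>) + b * a * (\<mu> - \<nu>)) = 0"
      using arg_cong[OF c[of a b], of uminus]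
      unfolding commutator_def[of _ \<mu>] c' scaleR_2 by (simp add: algebra_simps)
    have left: "(\<mu> - \<nu>) * (b * a) = b * a * (\<mu> - \<nu>)" by (rule centre_commute[OF z])
    have mid: "b * ((\<mu> - \<nu>) * a) = b * a * (\<mu> - \<nu>)" by (simp only: centre_commute[OF z] mult.assoc)
    have "b * \<delta> a + \<delta> b * a
        = b * a * \<mu> - \<mu> * (b * a) + ((\<mu> - \<nu>) * (b * a) + b * ((\<mu> - \<nu>) * a))"
      unfolding \<delta> by (simp add: algebra_simps)
    then show "b * \<delta> a + \<delta> b * a = 0" unfolding left mid zero .
  qed
  moreover have "?R2" if L: "?L2"
  proof -
    have "\<tau> c * a + c * \<delta> a = 0" if "a * c = 0" for a c
      using L[rule_format, of a "c\<^sup>\<star>"] that by (simp add: star_star \<tau>_def)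
    note struct = zero_product_pair_structure[where S = \<delta> and T = \<tau>,
        OF linear bounded \<tau> this, unfolded \<tau>_one]
    show ?R2
    proof (intro exI conjI allI)
      show "\<delta> a = a * 0 - (- \<delta> 1) * a" for a using struct(1)[of a] by simp
      show "re_part (- \<delta> 1) \<in> centre"
        using centre_minus[OF struct(3)] by (simp add: re_part_centre_iff star_minus add.commute)
      show "\<lbrakk>\<lbrakk>a, b\<rbrakk>\<^sub>c, - \<delta> 1\<rbrakk>\<^sub>c + (0 - - \<delta> 1)\<^sup>\<star> * \<lbrakk>a, b\<rbrakk>\<^sub>c + \<lbrakk>a, b\<rbrakk>\<^sub>c * (0 - - \<delta> 1) = 0" for a b
        using struct(4)[of a b] by (simp add: commutator_def[of "\<lbrakk>a, b\<rbrakk>\<^sub>c"] distrib_right)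
    qed
  qed
  moreover have "?L2" if R: "?R2"
  proof (intro allI impI)
    obtain \<mu> \<nu> where \<delta>: "\<And>a. \<delta> a = a * \<nu> - \<mu> * a" and z: "\<mu> + \<mu>\<^sup>\<star> \<in> centre"
      and c: "\<And>a b. \<lbrakk>\<lbrakk>a, b\<rbrakk>\<^sub>c, \<mu>\<rbrakk>\<^sub>c + (\<nu> - \<mu>)\<^sup>\<star> * \<lbrakk>a, b\<rbrakk>\<^sub>c + \<lbrakk>a, b\<rbrakk>\<^sub>c * (\<nu> - \<mu>) = 0"
      using R unfolding re_part_centre_iff by blast
    fix a b :: 'a assume ab: "a * b\<^sup>\<star> = 0"
    have c': "\<lbrakk>a, b\<^sup>\<star>\<rbrakk>\<^sub>c = - (b\<^sup>\<star> * a)" by (simp add: commutator_def ab)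
    have zero: "\<nu>\<^sup>\<star> * (b\<^sup>\<star> * a) + b\<^sup>\<star> * a * \<nu> - (\<mu> + \<mu>\<^sup>\<star>) * (b\<^sup>\<star> * a) = 0"
      using arg_cong[OF c[of a "b\<^sup>\<star>"], of uminus]
      unfolding commutator_def[of _ \<mu>] c' star_diff by (simp add: algebra_simps)
    have mid: "b\<^sup>\<star> * ((\<mu> + \<mu>\<^sup>\<star>) * a) = (\<mu> + \<mu>\<^sup>\<star>) * (b\<^sup>\<star> * a)"
      by (simp only: centre_commute[OF z] mult.assoc)
    have "(\<delta> b)\<^sup>\<star> * a + b\<^sup>\<star> * \<delta> a
        = \<nu>\<^sup>\<star> * (b\<^sup>\<star> * a) + b\<^sup>\<star> * a * \<nu> - b\<^sup>\<star> * ((\<mu> + \<mu>\<^sup>\<star>) * a)"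
      unfolding \<delta> star_diff star_mult by (simp add: algebra_simps)
    then show "(\<delta> b)\<^sup>\<star> * a + b\<^sup>\<star> * \<delta> a = 0" unfolding mid zero .
  qed
  moreover have "?R3" if L: "?L3"
  proof -
    have "\<delta> c * a + c * \<tau> a = 0" if "a * c = 0" for a c
      using L[rule_format, of "a\<^sup>\<star>" c] that by (simp add: star_star \<tau>_def)
    note struct = zero_product_pair_structure[where S = \<tau> and T = \<delta>,
        OF \<tau> linear bounded this, unfolded \<tau>_one]
    show ?R3
    proof (intro exI conjI allI)
      show "\<delta> a = a * \<delta> 1 - 0 * a" for a using struct(2)[of a] by simp
      show "re_part (\<delta> 1) \<in> centre"
        using struct(3) by (simp add: re_part_centre_iff add.commute)
      have "\<lbrakk>a, b\<rbrakk>\<^sub>c * ((\<delta> 1)\<^sup>\<star> + \<delta> 1) = 0" for a b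
        using struct(4)[of a b] centre_commute[OF struct(3), of "\<lbrakk>a, b\<rbrakk>\<^sub>c"] by simp
      then show "\<lbrakk>\<lbrakk>a, b\<rbrakk>\<^sub>c, \<delta> 1\<rbrakk>\<^sub>c + \<lbrakk>a, b\<rbrakk>\<^sub>c * (\<delta> 1 - 0)\<^sup>\<star> + (\<delta> 1 - 0) * \<lbrakk>a, b\<rbrakk>\<^sub>c = 0" for a b
        by (simp add: commutator_def[of "\<lbrakk>a, b\<rbrakk>\<^sub>c"] distrib_left add.commute)
    qed
  qed
  moreover have "?L3" if R: "?R3"
  proof (intro allI impI)
    obtain \<mu> \<nu> where \<delta>: "\<And>a. \<delta> a = a * \<mu> - \<nu> * a" and z: "\<mu> + \<mu>\<^sup>\<star> \<in> centre"
      and c: "\<And>a b. \<lbrakk>\<lbrakk>a, b\<rbrakk>\<^sub>c, \<mu>\<rbrakk>\<^sub>c + \<lbrakk>a, b\<rbrakk>\<^sub>c * (\<mu> - \<nu>)\<^sup>\<star> + (\<mu> - \<nu>) * \<lbrakk>a, b\<rbrakk>\<^sub>c = 0"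
      using R unfolding re_part_centre_iff by blast
    fix a b :: 'a assume ab: "a\<^sup>\<star> * b = 0"
    have c': "\<lbrakk>a\<^sup>\<star>, b\<rbrakk>\<^sub>c = - (b * a\<^sup>\<star>)" by (simp add: commutator_def ab)
    have zero: "b * a\<^sup>\<star> * (\<mu> + \<mu>\<^sup>\<star>) - b * a\<^sup>\<star> * \<nu>\<^sup>\<star> - \<nu> * (b * a\<^sup>\<star>) = 0"
      using arg_cong[OF c[of "a\<^sup>\<star>" b], of uminus]
      unfolding commutator_def[of _ \<mu>] c' star_diff by (simp add: algebra_simps)
    have mid: "b * ((\<mu> + \<mu>\<^sup>\<star>) * a\<^sup>\<star>) = b * a\<^sup>\<star> * (\<mu> + \<mu>\<^sup>\<star>)"
      by (simp only: centre_commute[OF z] mult.assoc)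
    have "\<delta> b * a\<^sup>\<star> + b * (\<delta> a)\<^sup>\<star>
        = b * ((\<mu> + \<mu>\<^sup>\<star>) * a\<^sup>\<star>) - b * a\<^sup>\<star> * \<nu>\<^sup>\<star> - \<nu> * (b * a\<^sup>\<star>)"
      unfolding \<delta> star_diff star_mult by (simp add: algebra_simps)
    then show "\<delta> b * a\<^sup>\<star> + b * (\<delta> a)\<^sup>\<star> = 0" unfolding mid zero .
  qed
  ultimately show ?thesis by blast
qed

end
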